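(* Let $D\ge1$ be an integer. If $\tau:[0,1]\to\mathbb R$ is bounded and measurable, then the Gibbs Free Energy with respect to $\tau$ is given by $$G(\tau)=E\Big[\log\sum_{j=1}^De^{\tau(U^j)}\Big]\quad\text{a.s.},$$ where $U^1,\dots,U^D$ are i.i.d. Unif$[0,1]$. Moreover, for every Borel probability measure $\nu$ on $[0,1]$, the grid entropy $\|\nu\|$ satisfies $$-\|\nu\|=\sup_\tau\big[\langle\tau,\nu\rangle-G(\tau)\big]=\sup_\tau\Big[\langle\tau,\nu\rangle-E\Big[\log\sum_{j=1}^De^{\tau(U^j)}\Big]\Big],$$ where the supremum is over bounded measurable functions $\tau:[0,1]\to\mathbb R$ and $\langle\tau,\nu\rangle=\int_0^1\tau(u)\,d\nu(u)$.
   Context: Let $(U_i^j)_{i\ge0,1\le j\le D}$ be i.i.d. Unif$[0,1]$. A path $\pi:0\to n$ is a sequence $(j_0,\dots,j_{n-1})\in\{1,\dots,D\}^n$, with $\frac1n\mu_\pi=\frac1n\sum_{i=0}^{n-1}\delta_{U_i^{j_i}}$ and passage time $T(\pi)=\sum_{i=0}^{n-1}\tau(U_i^{j_i})$. Gibbs Free Energy: $G(\tau)=\lim_{n\to\infty}\frac1n\log\sum_{\pi:0\to n}e^{T(\pi)}$ (an almost sure limit, the sum being over all $D^n$ paths). Grid entropy: let $\rho$ be the Levy-Prokhorov metric, $\rho(\mu,\nu)=\inf\{\epsilon>0:\mu(A)\le\nu(A^\epsilon)+\epsilon\text{ and }\nu(A)\le\mu(A^\epsilon)+\epsilon\ \forall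 A\text{ Borel}\}$, $A^\epsilon$ being the $\epsilon$-neighbourhood of $A$. For a Borel probability measure $\nu$ on $[0,1]$ let $\min^k_{\pi:0\to n}\rho(\frac1n\mu_\pi,\nu)$ be the $k$-th smallest of the $D^n$ values $\rho(\frac1n\mu_\pi,\nu)$ (counted with multiplicity), and $+\infty$ if $k>D^n$. Then $$\|\nu\|=\sup\Big\{\alpha\ge0:\lim_{n\to\infty}\min^{\lfloor e^{\alpha n}\rfloor}_{\pi:0\to n}\rho\big(\tfrac1n\mu_\pi,\nu\big)=0\text{ a.s.}\Big\},$$ with value $-\infty$ if the set of $\alpha$'s is empty. *)

theory Defs
  imports "HOL-Probability.Probability"
begin

abbreviation unit_borel :: "real measure" where
  "unit_borel \<equiv> restrict_space borel {0..1}"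

text \<open>Measurability into \<open>unit_borel\<close>, which is part of \<open>indep_vars\<close>, makes every value (not just
  almost every one) lie in \<open>{0..1}\<close>, so only the values of \<open>\<tau> :: real \<Rightarrow> real\<close> on \<open>{0..1}\<close> matter.\<close>

definition iid_unif01 :: "'a measure \<Rightarrow> 'i set \<Rightarrow> ('i \<Rightarrow> 'a \<Rightarrow> real) \<Rightarrow> bool" where
  "iid_unif01 M J X \<longleftrightarrow> prob_space M \<and> prob_space.indep_vars M (\<lambda>_. unit_borel) X J
     \<and> (\<forall>i\<in>J. distr M borel (X i) = uniform_measure lborel {0..1})"

definition bounded_measurable :: "(real \<Rightarrow> real) set" where
  "bounded_measurable = {\<tau>. \<tau> \<in> borel_measurable unit_borel \<and> bounded (\<tau> ` {0..1})}"

definition paths :: "nat \<Rightarrow> nat \<Rightarrow> (nat \<Rightarrow> nat) set" where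
  "paths D n = ({..<n} \<rightarrow>\<^sub>E {1..D})"

text \<open>Here \<open>u i j\<close> is a realisation of the environment. The library has no sum of measures, hence
  \<open>measure_of\<close>; the lemma below confirms that the resulting measure has the intended values.\<close>

definition path_measure :: "(nat \<Rightarrow> nat \<Rightarrow> real) \<Rightarrow> nat \<Rightarrow> (nat \<Rightarrow> nat) \<Rightarrow> real measure" where
  "path_measure u n \<pi> = measure_of {0..1} (sets unit_borel)
     (\<lambda>A. \<Sum>i<n. emeasure (return unit_borel (u i (\<pi> i))) A)"

lemma emeasure_path_measure:
  assumes "A \<in> sets unit_borel"
  shows "emeasure (path_measure u n \<pi>) A = (\<Sum>i<n. emeasure (return unit_borel (u i (\<pi> i))) A)"
proof (rule emeasure_measure_of[OF path_measure_def])
  show "sets unit_borel \<subseteq> Pow {0..1}"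
    using sets.space_closed[of unit_borel] by (simp add: space_restrict_space)
  have sets_eq: "sets (path_measure u n \<pi>) = sets unit_borel"
    unfolding path_measure_def using sets.sigma_sets_eq[of unit_borel]
      sets.space_closed[of unit_borel] by (simp add: space_restrict_space)
  then show "A \<in> sets (path_measure u n \<pi>)"
    using assms by simp
  show "positive (sets (path_measure u n \<pi>))
      (\<lambda>A. \<Sum>i<n. emeasure (return unit_borel (u i (\<pi> i))) A)"
    by (simp add: positive_def)
  show "countably_additive (sets (path_measure u n \<pi>))
      (\<lambda>A. \<Sum>i<n. emeasure (return unit_borel (u i (\<pi> i))) A)"
    unfolding sets_eq
  proof (rule countably_additiveI)
    fix B :: "nat \<Rightarrow> real set"
    assume B: "range B \<subseteq> sets unit_borel" "disjoint_family B"
    have "(\<Sum>k. \<Sum>i<n. emeasure (return unit_borel (u i (\<pi> i))) (B k))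
        = (\<Sum>i<n. \<Sum>k. emeasure (return unit_borel (u i (\<pi> i))) (B k))"
      by (rule suminf_sum) simp
    also have "\<dots> = (\<Sum>i<n. emeasure (return unit_borel (u i (\<pi> i))) (\<Union>k. B k))"
      using B by (intro sum.cong refl suminf_emeasure) auto
    finally show "(\<Sum>k. \<Sum>i<n. emeasure (return unit_borel (u i (\<pi> i))) (B k))
        = (\<Sum>i<n. emeasure (return unit_borel (u i (\<pi> i))) (\<Union>k. B k))" .
  qed
qed

definition empirical_measure :: "(nat \<Rightarrow> nat \<Rightarrow> real) \<Rightarrow> nat \<Rightarrow> (nat \<Rightarrow> nat) \<Rightarrow> real measure" where
  "empirical_measure u n \<pi> = scale_measure (1 / of_nat n) (path_measure u n \<pi>)"

definition passage_time ::
  "(real \<Rightarrow> real) \<Rightarrow> (nat \<Rightarrow> nat \<Rightarrow> real) \<Rightarrow> nat \<Rightarrow> (nat \<Rightarrow> nat) \<Rightarrow> real" where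
  "passage_time \<tau> u n \<pi> = (\<Sum>i<n. \<tau> (u i (\<pi> i)))"

definition free_energy ::
  "nat \<Rightarrow> (real \<Rightarrow> real) \<Rightarrow> (nat \<Rightarrow> nat \<Rightarrow> real) \<Rightarrow> nat \<Rightarrow> real" where
  "free_energy D \<tau> u n = 1 / real n * ln (\<Sum>\<pi>\<in>paths D n. exp (passage_time \<tau> u n \<pi>))"

text \<open>The constant that is the almost sure limit; it is only meaningful once that limit is known to
  exist.\<close>

definition Gibbs_free_energy ::
  "'a measure \<Rightarrow> nat \<Rightarrow> (nat \<Rightarrow> nat \<Rightarrow> 'a \<Rightarrow> real) \<Rightarrow> (real \<Rightarrow> real) \<Rightarrow> real" where
  "Gibbs_free_energy M D U \<tau> =
     (THE g. AE \<omega> in M. (\<lambda>n. free_energy D \<tau> (\<lambda>i j. U i j \<omega>) n) \<longlonglongrightarrow> g)"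

definition unit_nbhd :: "real \<Rightarrow> real set \<Rightarrow> real set" where
  "unit_nbhd \<epsilon> A = {y \<in> {0..1}. \<exists>x\<in>A. dist x y < \<epsilon>}"

definition levy_prokhorov :: "real measure \<Rightarrow> real measure \<Rightarrow> real" where
  "levy_prokhorov \<mu> \<nu> = Inf {\<epsilon>. \<epsilon> > 0 \<and> (\<forall>A\<in>sets unit_borel.
     measure \<mu> A \<le> measure \<nu> (unit_nbhd \<epsilon> A) + \<epsilon> \<and>
     measure \<nu> A \<le> measure \<mu> (unit_nbhd \<epsilon> A) + \<epsilon>)}"

text \<open>Intended for finite \<open>S\<close> and \<open>k \<ge> 1\<close>; the list index starts at 0.\<close>

definition kth_smallest :: "nat \<Rightarrow> ('b \<Rightarrow> real) \<Rightarrow> 'b set \<Rightarrow> ereal" where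
  "kth_smallest k f S = (if k > card S then \<infinity>
     else ereal (sorted_list_of_multiset (image_mset f (mset_set S)) ! (k - 1)))"

text \<open>In \<open>ereal\<close>, the supremum of the empty set is \<open>-\<infinity>\<close>.\<close>

definition grid_entropy ::
  "'a measure \<Rightarrow> nat \<Rightarrow> (nat \<Rightarrow> nat \<Rightarrow> 'a \<Rightarrow> real) \<Rightarrow> real measure \<Rightarrow> ereal" where
  "grid_entropy M D U \<nu> = Sup {ereal \<alpha> | \<alpha>. \<alpha> \<ge> 0 \<and>
     (AE \<omega> in M. (\<lambda>n. kth_smallest (nat \<lfloor>exp (\<alpha> * real n)\<rfloor>)
        (\<lambda>\<pi>. levy_prokhorov (empirical_measure (\<lambda>i j. U i j \<omega>) n \<pi>) \<nu>) (paths D n))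
        \<longlonglongrightarrow> 0)}"

end

theory Submission
  imports Defs
begin

text \<open>The sum over all paths factorises over the rows, so the free energy is an average of i.i.d. bounded
  variables and converges to \<open>\<Lambda> \<tau> = E [ln \<Sum>\<^sub>j exp (\<tau> (U\<^sup>j))]\<close> by Hoeffding's inequality and
  Borel-Cantelli.

  If about \<open>exp (\<alpha> n)\<close> paths have empirical measure close to \<open>\<nu>\<close>, then they alone contribute
  \<open>\<alpha> + \<langle>\<tau>, \<nu>\<rangle>\<close> to the free energy, which gives \<open>\<alpha> \<le> \<Lambda> \<tau> - \<langle>\<tau>, \<nu>\<rangle>\<close>; as \<open>\<tau>\<close> need not be
  continuous, it is first replaced by a combination of indicators of open neighbourhoods of compact
  subsets of its superlevel sets.

  Conversely, let \<open>\<beta>\<close> be the infimum of \<open>\<Lambda> \<tau> - \<langle>\<tau>, \<nu>\<rangle>\<close>. Cut \<open>[0, 1]\<close> into bins and let the step function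
  \<open>\<tau>\<close> nearly minimise \<open>\<Lambda> \<tau> - \<langle>\<tau>, \<nu>\<rangle>\<close> plus a small quadratic penalty, which stands in for the missing
  coercivity. The gradient of \<open>\<Lambda>\<close> at \<open>\<tau>\<close> is then close to the bin weights of \<open>\<nu>\<close>, and a Chernoff bound
  shows that under the Gibbs weights \<open>exp (T \<pi>)\<close> most of the mass sits on paths whose bin frequencies are
  close to that gradient; hence there are about \<open>exp (\<beta> n)\<close> of them.\<close>

subsection \<open>Elementary inequalities\<close>

text \<open>One factor of each power is bounded by the whole sum, and induction handles the rest.
  With \<open>a j\<close> = exp (\<tau> (v j)) this compares the log-partition of (n + 1) \<tau>
  with that of \<tau>. The exponent is a successor because at exponent 0 the left side would count
  J.\<close>

lemma sum_power_le_power_sum: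
  fixes a :: "'i \<Rightarrow> real"
  assumes "\<And>j. j \<in> J \<Longrightarrow> 0 \<le> a j"
  shows "(\<Sum>j\<in>J. a j ^ Suc n) \<le> (\<Sum>j\<in>J. a j) ^ Suc n"
proof (cases "finite J")
  case True
  show ?thesis
  proof (induction n)
    case (Suc n)
    have "(\<Sum>j\<in>J. a j ^ Suc (Suc n)) \<le> (\<Sum>j\<in>J. (\<Sum>k\<in>J. a k) * a j ^ Suc n)"
      unfolding power_Suc[of _ "Suc n"]
      using True assms by (intro sum_mono mult_right_mono member_le_sum) auto
    also have "\<dots> = (\<Sum>k\<in>J. a k) * (\<Sum>j\<in>J. a j ^ Suc n)"
      by (rule sum_distrib_left[symmetric])
    also have "\<dots> \<le> (\<Sum>k\<in>J. a k) * (\<Sum>j\<in>J. a j) ^ Suc n"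
      using Suc assms by (intro mult_left_mono sum_nonneg) auto
    finally show ?case by simp
  qed simp
qed simp

lemma sum_Un_le:
  fixes f :: "'b \<Rightarrow> real"
  assumes "finite A" "finite B" "\<And>x. 0 \<le> f x"
  shows "sum f (A \<union> B) \<le> sum f A + sum f B"
  using assms by (simp add: sum_Un sum_nonneg)

lemma sum_UNION_le:
  fixes f :: "'b \<Rightarrow> real"
  assumes "finite I" "\<And>i. i \<in> I \<Longrightarrow> finite (A i)" "\<And>x. 0 \<le> f x"
  shows "sum f (\<Union>i\<in>I. A i) \<le> (\<Sum>i\<in>I. sum f (A i))"
  using assms(1,2)
proof (induction I rule: finite_induct)
  case (insert i I)
  then have "sum f (A i \<union> (\<Union>i\<in>I. A i)) \<le> sum f (A i) + sum f (\<Union>i\<in>I. A i)"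
    by (intro sum_Un_le assms(3)) auto
  also have "sum f (\<Union>i\<in>I. A i) \<le> (\<Sum>i\<in>I. sum f (A i))"
    using insert by simp
  finally show ?case using insert by simp
qed simp

lemma exp_le_quadratic:
  fixes x :: real
  assumes "\<bar>x\<bar> \<le> 1"
  shows "exp x \<le> 1 + x + x\<^sup>2"
proof (cases "x \<ge> 0")
  case True
  then show ?thesis using assms exp_bound by auto
next
  case False
  define y where "y = - x"
  have y: "0 < y" "y \<le> 1" using False assms by (auto simp: y_def)
  \<comment> \<open>For negative x the claim is exp (-y) \<le> 1 - y + y^2 with y = -x. Multiplying
    the quadratic by 1 + y gives 1 + y^3 \<ge> 1, and 1 + y \<le> exp y finishes.\<close>
  have "(1 - y + y\<^sup>2) * (1 + y) = 1 + y ^ 3"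
    by (simp add: algebra_simps power2_eq_square power3_eq_cube)
  moreover have "1 - y + y\<^sup>2 \<ge> 0" using y by (smt (verit) zero_le_power2)
  then have "(1 - y + y\<^sup>2) * (1 + y) \<le> (1 - y + y\<^sup>2) * exp y"
    by (intro mult_left_mono exp_ge_add_one_self)
  ultimately have "1 \<le> (1 - y + y\<^sup>2) * exp y"
    using y by (smt (verit) zero_le_power)
  then have "exp (- y) \<le> 1 - y + y\<^sup>2"
    by (simp add: exp_minus inverse_eq_divide pos_divide_le_eq)
  then show ?thesis by (simp add: y_def)
qed

text \<open>Replacing each \<open>d j\<close> by the total lets its exponential leave the sum. The
  total, unlike a supremum of d, has small expectation when d is large only on a small set.\<close>

lemma ln_sum_exp_add_le:
  fixes a d :: "'i \<Rightarrow> real"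
  assumes J: "finite J" "J \<noteq> {}" and d: "\<And>j. j \<in> J \<Longrightarrow> 0 \<le> d j"
  shows "ln (\<Sum>j\<in>J. exp (a j + d j)) \<le> ln (\<Sum>j\<in>J. exp (a j)) + (\<Sum>j\<in>J. d j)"
proof -
  have pos: "0 < (\<Sum>j\<in>J. exp (a j))" "0 < (\<Sum>j\<in>J. exp (a j + d j))"
    using J by (auto intro!: sum_pos)
  have "(\<Sum>j\<in>J. exp (a j + d j)) \<le> (\<Sum>j\<in>J. exp (a j) * exp (\<Sum>j\<in>J. d j))"
    unfolding exp_add using J d by (intro sum_mono mult_left_mono) (auto intro!: member_le_sum)
  also have "\<dots> = (\<Sum>j\<in>J. exp (a j)) * exp (\<Sum>j\<in>J. d j)"
    by (rule sum_distrib_right[symmetric])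
  finally have "ln (\<Sum>j\<in>J. exp (a j + d j)) \<le> ln ((\<Sum>j\<in>J. exp (a j)) * exp (\<Sum>j\<in>J. d j))"
    using pos by simp
  then show ?thesis using pos by (simp add: ln_mult)
qed

text \<open>A first-order expansion in t with an explicit quadratic error: the slope is the Gibbs
  average of h under the weights exp (a j), that is, the derivative at t = 0. It comes from exp x
  \<le> 1 + x + x^2 inside the sum and ln z \<le> z - 1 outside.\<close>

lemma ln_sum_exp_tilt_le:
  fixes a h :: "'i \<Rightarrow> real"
  assumes J: "finite J" "J \<noteq> {}" and h: "\<And>j. j \<in> J \<Longrightarrow> 0 \<le> h j" "\<And>j. j \<in> J \<Longrightarrow> h j \<le> 1"
    and t: "\<bar>t\<bar> \<le> 1"
  shows "ln (\<Sum>j\<in>J. exp (a j + t * h j))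
    \<le> ln (\<Sum>j\<in>J. exp (a j)) + t * ((\<Sum>j\<in>J. exp (a j) * h j) / (\<Sum>j\<in>J. exp (a j))) + t\<^sup>2"
proof -
  define Z where "Z = (\<Sum>j\<in>J. exp (a j))"
  define g where "g = (\<Sum>j\<in>J. exp (a j) * h j) / Z"
  have pos: "0 < Z" "0 < (\<Sum>j\<in>J. exp (a j + t * h j))"
    using J by (auto intro!: sum_pos simp: Z_def)
  have *: "exp (t * h j) \<le> 1 + t * h j + t\<^sup>2" if "j \<in> J" for j
  proof -
    have h1: "\<bar>h j\<bar> \<le> 1" using h[OF that] by auto
    have "\<bar>t * h j\<bar> \<le> 1" using mult_mono[OF t h1] by (simp add: abs_mult)
    then have "exp (t * h j) \<le> 1 + t * h j + (t * h j)\<^sup>2" by (rule exp_le_quadratic)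
    also have "(t * h j)\<^sup>2 \<le> t\<^sup>2 * 1"
      unfolding power_mult_distrib using h1 by (intro mult_left_mono) (auto simp: abs_square_le_1)
    finally show ?thesis by simp
  qed
  have "(\<Sum>j\<in>J. exp (a j + t * h j)) \<le> (\<Sum>j\<in>J. exp (a j) * (1 + t * h j + t\<^sup>2))"
    unfolding exp_add using * by (intro sum_mono mult_left_mono) auto
  also have "\<dots> = Z + t * (\<Sum>j\<in>J. exp (a j) * h j) + t\<^sup>2 * Z"
    by (simp add: Z_def algebra_simps sum.distrib sum_distrib_left)
  also have "(\<Sum>j\<in>J. exp (a j) * h j) = g * Z" using pos by (simp add: g_def)
  finally have le: "(\<Sum>j\<in>J. exp (a j + t * h j)) \<le> Z * (1 + t * g + t\<^sup>2)"
    by (simp add: algebra_simps)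
  then have p: "0 < 1 + t * g + t\<^sup>2"
    using pos by (smt (verit) zero_less_mult_pos)
  have "ln (\<Sum>j\<in>J. exp (a j + t * h j)) \<le> ln (Z * (1 + t * g + t\<^sup>2))"
    using le pos by simp
  also have "\<dots> = ln Z + ln (1 + t * g + t\<^sup>2)" using pos p by (simp add: ln_mult)
  also have "ln (1 + t * g + t\<^sup>2) \<le> t * g + t\<^sup>2"
    using ln_le_minus_one[OF p] by simp
  finally show ?thesis by (simp add: g_def Z_def)
qed

subsection \<open>The strong law of large numbers for bounded variables\<close>

lemma (in prob_space) strong_law_bounded:
  fixes X :: "nat \<Rightarrow> 'a \<Rightarrow> real"
  assumes indep: "indep_vars (\<lambda>_. borel) X UNIV"
    and bound: "\<And>i x. x \<in> space M \<Longrightarrow> \<bar>X i x\<bar> \<le> C"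
    and mean: "\<And>i. expectation (X i) = m"
  shows "AE x in M. (\<lambda>n. (\<Sum>i<n. X i x) / real n) \<longlonglongrightarrow> m"
proof -
  have [measurable]: "X i \<in> borel_measurable M" for i
    using indep by (auto simp: indep_vars_def)
  \<comment> \<open>Hoeffding's bound divides by the squared widths, so the range from -B to B must
    have positive length even when C = 0.\<close>
  define B where "B = max C 1"
  have B: "B > 0" "C \<le> B" by (auto simp: B_def)
  define A where "A e n = {x\<in>space M. \<bar>(\<Sum>i<n. X i x) - real n * m\<bar> \<ge> e * real n}" for e n
  have [measurable]: "A e n \<in> events" for e n unfolding A_def by measurable
  have prob_A: "prob (A e n) \<le> 2 * exp (- (e\<^sup>2 / (2 * B\<^sup>2))) ^ n" if e: "e > 0" for e n
  proof (cases "n = 0")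
    case True
    have "prob (A e n) \<le> 2" by (rule order_trans[OF prob_le_1]) simp
    then show ?thesis by (simp add: True)
  next
    case False
    interpret H: Hoeffding_ineq M "{..<n}" X "\<lambda>_. - B" "\<lambda>_. B" "\<Sum>i<n. expectation (X i)"
    proof unfold_locales
      show "indep_vars (\<lambda>_. borel) X {..<n}" by (rule indep_vars_subset[OF indep]) simp
      show "AE x in M. X i x \<in> {- B..B}" for i
        using bound B by (intro AE_I2) (smt (verit) atLeastAtMost_iff)
    qed auto
    have "prob (A e n) \<le> 2 * exp (-2 * (e * real n)\<^sup>2 / (\<Sum>i<n. (B - - B)\<^sup>2))"
      using H.Hoeffding_ineq_abs_ge[of "e * real n"] e False B by (simp add: A_def mean)
    \<comment> \<open>The n intervals of width 2 B contribute 4 n B^2, so the exponent is linear in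
      n and the tails form a geometric, hence summable, sequence.\<close>
    also have "-2 * (e * real n)\<^sup>2 / (\<Sum>i<n. (B - - B)\<^sup>2) = real n * (- (e\<^sup>2 / (2 * B\<^sup>2)))"
      using False B by (simp add: field_simps power2_eq_square)
    finally show ?thesis by (simp only: exp_of_nat_mult)
  qed
  have ev: "AE x in M. \<forall>\<^sub>F n in sequentially. x \<in> space M - A e n" if e: "e > 0" for e
  proof (rule borel_cantelli_AE1)
    show "summable (\<lambda>n. prob (A e n))"
    proof (rule summable_comparison_test')
      show "summable (\<lambda>n. 2 * exp (- (e\<^sup>2 / (2 * B\<^sup>2))) ^ n)"
        using e B by (intro summable_mult summable_geometric) simp
      show "norm (prob (A e n)) \<le> 2 * exp (- (e\<^sup>2 / (2 * B\<^sup>2))) ^ n" for n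
        using prob_A[OF e] by simp
    qed
  qed (auto simp: emeasure_eq_measure)
  \<comment> \<open>Countably many tolerances suffice, so that one null set serves every e >
    0.\<close>
  have "AE x in M. \<forall>k::nat. \<forall>\<^sub>F n in sequentially. x \<in> space M - A (1 / real (Suc k)) n"
    by (intro AE_all_countable[THEN iffD2] allI ev) simp
  then show ?thesis
  proof eventually_elim
    case (elim x)
    show ?case
    proof (rule tendstoI)
      fix e :: real assume "e > 0"
      then obtain k where k: "1 / real (Suc k) < e" using nat_approx_posE by blast
      from elim[rule_format, of k] eventually_gt_at_top[of 0]
      show "\<forall>\<^sub>F n in sequentially. dist ((\<Sum>i<n. X i x) / real n) m < e"
      proof eventually_elim
        case (elim n)
        then have "\<bar>(\<Sum>i<n. X i x) - real n * m\<bar> < 1 / real (Suc k) * real n"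
          by (auto simp: A_def)
        also have "\<dots> \<le> e * real n" using k by (intro mult_right_mono) auto
        finally have "\<bar>(\<Sum>i<n. X i x) - real n * m\<bar> / real n < e"
          using elim by (simp add: pos_divide_less_eq)
        also have "\<bar>(\<Sum>i<n. X i x) - real n * m\<bar> / real n = \<bar>((\<Sum>i<n. X i x) - real n * m) / real n\<bar>"
          by simp
        also have "((\<Sum>i<n. X i x) - real n * m) / real n = (\<Sum>i<n. X i x) / real n - m"
          using elim by (simp add: diff_divide_distrib)
        finally show ?case by (simp add: dist_real_def)
      qed
    qed
  qed
qed

subsection \<open>Bounded measurable functions on the unit interval\<close>

lemma bounded_measurableD:
  assumes "\<tau> \<in> bounded_measurable"
  shows "\<tau> \<in> borel_measurable unit_borel" "\<exists>C>0. \<forall>x\<in>{0..1}. \<bar>\<tau> x\<bar> \<le> C"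
  using assms unfolding bounded_measurable_def bounded_pos by auto

lemma bounded_measurableI:
  assumes "\<tau> \<in> borel_measurable unit_borel" "\<And>x. x \<in> {0..1} \<Longrightarrow> \<bar>\<tau> x\<bar> \<le> C"
  shows "\<tau> \<in> bounded_measurable"
  using assms(1) unfolding bounded_measurable_def bounded_iff
  by (auto intro!: exI[of _ C] assms(2))

lemma bounded_measurable_const: "(\<lambda>_. c) \<in> bounded_measurable"
  by (rule bounded_measurableI[of _ "\<bar>c\<bar>"]) auto

lemma bounded_measurable_add:
  assumes "\<tau> \<in> bounded_measurable" "\<sigma> \<in> bounded_measurable"
  shows "(\<lambda>x. \<tau> x + \<sigma> x) \<in> bounded_measurable"
proof -
  note [measurable] = bounded_measurableD(1)[OF assms(1)] bounded_measurableD(1)[OF assms(2)]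
  obtain A B where "\<And>x. x \<in> {0..1} \<Longrightarrow> \<bar>\<tau> x\<bar> \<le> A" "\<And>x. x \<in> {0..1} \<Longrightarrow> \<bar>\<sigma> x\<bar> \<le> B"
    using bounded_measurableD(2)[OF assms(1)] bounded_measurableD(2)[OF assms(2)] by blast
  then have "\<bar>\<tau> x + \<sigma> x\<bar> \<le> A + B" if "x \<in> {0..1}" for x
    using abs_triangle_ineq[of "\<tau> x" "\<sigma> x"] that by force
  then show ?thesis by (intro bounded_measurableI[of _ "A + B"]) auto
qed

lemma bounded_measurable_cmult:
  assumes "\<tau> \<in> bounded_measurable"
  shows "(\<lambda>x. c * \<tau> x) \<in> bounded_measurable"
proof -
  note [measurable] = bounded_measurableD(1)[OF assms(1)]
  obtain A where "\<And>x. x \<in> {0..1} \<Longrightarrow> \<bar>\<tau> x\<bar> \<le> A"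
    using bounded_measurableD(2)[OF assms(1)] by blast
  then have "\<bar>c * \<tau> x\<bar> \<le> \<bar>c\<bar> * A" if "x \<in> {0..1}" for x
    using that by (simp add: abs_mult mult_left_mono)
  then show ?thesis by (intro bounded_measurableI[of _ "\<bar>c\<bar> * A"]) auto
qed

lemma bounded_measurable_sum:
  assumes "\<And>i. i \<in> I \<Longrightarrow> f i \<in> bounded_measurable"
  shows "(\<lambda>x. \<Sum>i\<in>I. f i x) \<in> bounded_measurable"
  using assms by (induction I rule: infinite_finite_induct)
    (auto intro!: bounded_measurable_const bounded_measurable_add)

lemma bounded_measurable_indicator:
  assumes "A \<inter> {0..1} \<in> sets unit_borel"
  shows "indicator A \<in> bounded_measurable"
proof (rule bounded_measurableI[of _ 1])
  show "(indicator A :: real \<Rightarrow> real) \<in> borel_measurable unit_borel"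
    using assms by (simp add: borel_measurable_indicator_iff space_restrict_space Int_commute)
qed (auto simp: indicator_def)

subsection \<open>The log-partition function\<close>

definition log_partition :: "nat \<Rightarrow> (real \<Rightarrow> real) \<Rightarrow> (nat \<Rightarrow> real) \<Rightarrow> real" where
  "log_partition D \<tau> v = ln (\<Sum>j=1..D. exp (\<tau> (v j)))"

lemma free_energy_eq_average:
  assumes "D \<ge> 1"
  shows "free_energy D \<tau> u n = (\<Sum>i<n. log_partition D \<tau> (u i)) / real n"
proof -
  have "(\<Sum>\<pi>\<in>paths D n. exp (passage_time \<tau> u n \<pi>))
      = (\<Sum>\<pi>\<in>{..<n} \<rightarrow>\<^sub>E {1..D}. \<Prod>i<n. exp (\<tau> (u i (\<pi> i))))"
    by (simp add: paths_def passage_time_def exp_sum)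
  \<comment> \<open>Distributivity: a path chooses one column in each row, freely.\<close>
  also have "\<dots> = (\<Prod>i<n. \<Sum>j=1..D. exp (\<tau> (u i j)))"
    by (rule prod_sum_PiE[symmetric]) auto
  also have "ln \<dots> = (\<Sum>i<n. log_partition D \<tau> (u i))"
    unfolding log_partition_def
  proof (rule ln_prod)
    have "(\<Sum>j=1..D. exp (\<tau> (u i j))) > 0" for i
      using assms by (intro sum_pos) auto
    then show "(\<Sum>j=1..D. exp (\<tau> (u i j))) \<noteq> 0" for i
      by (metis less_irrefl)
  qed simp
  finally show ?thesis by (simp add: free_energy_def)
qed

lemma abs_log_partition_le:
  assumes "D \<ge> 1" "\<And>j. j \<in> {1..D} \<Longrightarrow> \<bar>\<tau> (v j)\<bar> \<le> C"
  shows "\<bar>log_partition D \<tau> v\<bar> \<le> C + ln (real D)"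
proof -
  have pos: "0 < (\<Sum>j=1..D. exp (\<tau> (v j)))" using assms(1) by (intro sum_pos) auto
  have "(\<Sum>j=1..D. exp (\<tau> (v j))) \<le> (\<Sum>j=1..D. exp C)"
    using assms(2) by (intro sum_mono) (auto simp: abs_le_iff)
  then have "ln (\<Sum>j=1..D. exp (\<tau> (v j))) \<le> ln (real D * exp C)"
    using pos assms(1) by simp
  moreover have "(\<Sum>j=1..D. exp (- C)) \<le> (\<Sum>j=1..D. exp (\<tau> (v j)))"
    using assms(2) by (intro sum_mono) (auto simp: abs_le_iff minus_le_iff)
  then have "ln (real D * exp (- C)) \<le> ln (\<Sum>j=1..D. exp (\<tau> (v j)))"
    using pos assms(1) by simp
  moreover have "0 \<le> ln (real D)" using assms(1) by simp
  moreover have "ln (real D * exp c) = ln (real D) + c" for c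
    using assms(1) by (simp add: ln_mult)
  ultimately have "ln (\<Sum>j=1..D. exp (\<tau> (v j))) \<le> C + ln (real D)"
    "- (C + ln (real D)) \<le> ln (\<Sum>j=1..D. exp (\<tau> (v j)))"
    by (smt (verit))+
  then show ?thesis
    by (simp add: log_partition_def abs_le_iff)
qed

lemma measurable_log_partition:
  assumes \<tau>: "\<tau> \<in> borel_measurable unit_borel"
    and X: "\<And>j. j \<in> {1..D} \<Longrightarrow> X j \<in> measurable N unit_borel"
  shows "(\<lambda>x. log_partition D \<tau> (\<lambda>j. X j x)) \<in> borel_measurable N"
  unfolding log_partition_def
  using measurable_compose[OF X \<tau>] by measurable

text \<open>\<open>iid_unif01\<close> prescribes the laws on the Borel sets of the line, while
  independence and the product measures use \<open>unit_borel\<close>. Every set of the latter is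
  Borel on the line, so equality of laws carries over.\<close>

lemma distr_unit_borel_eqI:
  assumes X: "X \<in> measurable M unit_borel" and Y: "Y \<in> measurable N unit_borel"
    and eq: "distr M borel X = distr N borel Y"
  shows "distr M unit_borel X = distr N unit_borel Y"
proof (rule measure_eqI)
  fix A assume "A \<in> sets (distr M unit_borel X)"
  then have A: "A \<in> sets unit_borel" by simp
  then have B: "A \<in> sets borel" by (auto simp: sets_restrict_space)
  have [measurable]: "X \<in> borel_measurable M" "Y \<in> borel_measurable N"
    using X Y by (auto dest: measurable_restrict_space2_iff[THEN iffD1])
  have "emeasure (distr M borel X) A = emeasure (distr N borel Y) A" by (simp add: eq)
  then show "emeasure (distr M unit_borel X) A = emeasure (distr N unit_borel Y) A"
    using A B X Y by (simp add: emeasure_distr)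
qed simp

section \<open>One row of the environment and its mean log-partition function\<close>

locale unif_row = prob_space N for N :: "'b measure" +
  fixes D :: nat and V :: "nat \<Rightarrow> 'b \<Rightarrow> real"
  assumes D: "D \<ge> 1" and iid: "iid_unif01 N {1..D} V"
begin

text \<open>The functional written \<Lambda> in the overview, which is the claimed value of the
  Gibbs free energy.\<close>

definition mean_log_partition :: "(real \<Rightarrow> real) \<Rightarrow> real" where
  "mean_log_partition \<tau> = expectation (\<lambda>x. log_partition D \<tau> (\<lambda>j. V j x))"

lemma V_measurable: "j \<in> {1..D} \<Longrightarrow> V j \<in> measurable N unit_borel"
  using iid by (auto simp: iid_unif01_def indep_vars_def)

lemma V_in_unit: "j \<in> {1..D} \<Longrightarrow> x \<in> space N \<Longrightarrow> V j x \<in> {0..1}"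
  using measurable_space[OF V_measurable] by (simp add: space_restrict_space)

lemma integrable_log_partition:
  assumes "\<tau> \<in> bounded_measurable"
  shows "integrable N (\<lambda>x. log_partition D \<tau> (\<lambda>j. V j x))"
proof -
  obtain C where C: "\<forall>x\<in>{0..1}. \<bar>\<tau> x\<bar> \<le> C" using bounded_measurableD(2)[OF assms] by blast
  show ?thesis
  proof (rule integrable_const_bound[of _ "C + ln (real D)"])
    show "AE x in N. norm (log_partition D \<tau> (\<lambda>j. V j x)) \<le> C + ln (real D)"
      unfolding real_norm_def using C V_in_unit by (intro AE_I2 abs_log_partition_le D) blast
  qed (rule measurable_log_partition[OF bounded_measurableD(1)[OF assms] V_measurable])
qed

lemma mean_log_partition_mono:
  assumes "\<tau> \<in> bounded_measurable" "\<sigma> \<in> bounded_measurable"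
    and "\<And>x. x \<in> {0..1} \<Longrightarrow> \<tau> x \<le> \<sigma> x"
  shows "mean_log_partition \<tau> \<le> mean_log_partition \<sigma>"
  unfolding mean_log_partition_def
proof (rule integral_mono[OF integrable_log_partition integrable_log_partition])
  fix x assume "x \<in> space N"
  then have "(\<Sum>j=1..D. exp (\<tau> (V j x))) \<le> (\<Sum>j=1..D. exp (\<sigma> (V j x)))"
    using assms(3) V_in_unit by (intro sum_mono) auto
  moreover have "0 < (\<Sum>j=1..D. exp (\<tau> (V j x)))" using D by (intro sum_pos) auto
  ultimately show "log_partition D \<tau> (\<lambda>j. V j x) \<le> log_partition D \<sigma> (\<lambda>j. V j x)"
    by (simp add: log_partition_def)
qed (use assms in auto)

lemma mean_log_partition_add_const:
  assumes "\<tau> \<in> bounded_measurable"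
  shows "mean_log_partition (\<lambda>x. \<tau> x + c) = mean_log_partition \<tau> + c"
proof -
  have "log_partition D (\<lambda>x. \<tau> x + c) v = log_partition D \<tau> v + c" for v
  proof -
    have "0 < (\<Sum>j=1..D. exp (\<tau> (v j)))" using D by (intro sum_pos) auto
    then show ?thesis by (simp add: log_partition_def exp_add ln_mult flip: sum_distrib_right)
  qed
  then show ?thesis
    using integrable_log_partition[OF assms] by (simp add: mean_log_partition_def prob_space)
qed

text \<open>Pointwise this is \<open>sum_power_le_power_sum\<close> after taking logarithms. It
  makes the gap between the integral of \<tau> and its mean log-partition grow at least linearly
  under integer scaling.\<close>

lemma mean_log_partition_mult_le:
  assumes "\<tau> \<in> bounded_measurable"
  shows "mean_log_partition (\<lambda>x. real (Suc n) * \<tau> x) \<le> real (Suc n) * mean_log_partition \<tau>"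
proof -
  have le: "log_partition D (\<lambda>x. real (Suc n) * \<tau> x) v \<le> real (Suc n) * log_partition D \<tau> v" for v
  proof -
    have pos: "0 < (\<Sum>j=1..D. exp (\<tau> (v j)))" "0 < (\<Sum>j=1..D. exp (\<tau> (v j)) ^ Suc n)"
      using D by (auto intro!: sum_pos)
    have "(\<Sum>j=1..D. exp (\<tau> (v j)) ^ Suc n) \<le> (\<Sum>j=1..D. exp (\<tau> (v j))) ^ Suc n"
      by (rule sum_power_le_power_sum) simp
    then have "ln (\<Sum>j=1..D. exp (\<tau> (v j)) ^ Suc n) \<le> ln ((\<Sum>j=1..D. exp (\<tau> (v j))) ^ Suc n)"
      using pos by (intro ln_mono) auto
    also have "\<dots> = real (Suc n) * ln (\<Sum>j=1..D. exp (\<tau> (v j)))"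
      using pos by (rule_tac ln_realpow)
    finally show ?thesis
      unfolding log_partition_def exp_of_nat_mult .
  qed
  have "mean_log_partition (\<lambda>x. real (Suc n) * \<tau> x)
      \<le> expectation (\<lambda>x. real (Suc n) * log_partition D \<tau> (\<lambda>j. V j x))"
    unfolding mean_log_partition_def
    using assms le by (intro integral_mono integrable_log_partition bounded_measurable_cmult
        integrable_mult_right) auto
  then show ?thesis by (simp add: mean_log_partition_def)
qed

text \<open>Integrate \<open>ln_sum_exp_add_le\<close>: each of the D columns is uniform and
  contributes the same integral of d. An increment with small Lebesgue integral is therefore cheap
  even where it is not small.\<close>

lemma mean_log_partition_add_le:
  assumes \<tau>: "\<tau> \<in> bounded_measurable" and d: "d \<in> borel_measurable borel"
    and d_bounds: "\<And>x. 0 \<le> d x" "\<And>x. d x \<le> B"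
  shows "mean_log_partition (\<lambda>x. \<tau> x + d x)
    \<le> mean_log_partition \<tau> + real D * (\<integral>x. d x \<partial>uniform_measure lborel {0..1})"
proof -
  have [measurable]: "V j \<in> borel_measurable N" if "j \<in> {1..D}" for j
    using V_measurable[OF that] by (auto dest: measurable_restrict_space2_iff[THEN iffD1])
  note d[measurable]
  have int_d: "integrable N (\<lambda>x. d (V j x))" if j: "j \<in> {1..D}" for j
    using d_bounds j by (intro integrable_const_bound[of _ B] AE_I2) (auto simp: abs_le_iff)
  have exp_d: "expectation (\<lambda>x. d (V j x)) = (\<integral>x. d x \<partial>uniform_measure lborel {0..1})"
    if j: "j \<in> {1..D}" for j
  proof -
    have "distr N borel (V j) = uniform_measure lborel {0..1}"
      using iid j by (auto simp: iid_unif01_def)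
    then show ?thesis
      using j by (simp flip: integral_distr[of "V j" N borel d])
  qed
  have d_bm: "d \<in> bounded_measurable"
    using d d_bounds by (intro bounded_measurableI[of _ B] measurable_restrict_space1) (auto simp: abs_le_iff)
  have "mean_log_partition (\<lambda>x. \<tau> x + d x)
      \<le> expectation (\<lambda>x. log_partition D \<tau> (\<lambda>j. V j x) + (\<Sum>j=1..D. d (V j x)))"
    unfolding mean_log_partition_def
  proof (rule integral_mono)
    show "integrable N (\<lambda>x. log_partition D (\<lambda>x. \<tau> x + d x) (\<lambda>j. V j x))"
      by (intro integrable_log_partition bounded_measurable_add \<tau> d_bm)
    show "integrable N (\<lambda>x. log_partition D \<tau> (\<lambda>j. V j x) + (\<Sum>j=1..D. d (V j x)))"
      using int_d by (intro Bochner_Integration.integrable_add integrable_log_partition \<tau>) auto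
    show "log_partition D (\<lambda>x. \<tau> x + d x) (\<lambda>j. V j x)
        \<le> log_partition D \<tau> (\<lambda>j. V j x) + (\<Sum>j=1..D. d (V j x))" for x
      unfolding log_partition_def using D d_bounds by (intro ln_sum_exp_add_le) auto
  qed
  also have "\<dots> = mean_log_partition \<tau> + (\<Sum>j=1..D. expectation (\<lambda>x. d (V j x)))"
    unfolding mean_log_partition_def using int_d integrable_log_partition[OF \<tau>]
    by (subst Bochner_Integration.integral_add) auto
  finally show ?thesis by (simp add: exp_d)
qed

text \<open>The witness g is the expected Gibbs average of h over the row, the directional
  derivative at \<tau>. As h takes values in [0, 1], so does this average, which makes it
  integrable.\<close>

lemma mean_log_partition_tilt:
  assumes \<tau>: "\<tau> \<in> bounded_measurable" and h: "h \<in> bounded_measurable"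
    and h_bounds: "\<And>x. x \<in> {0..1} \<Longrightarrow> 0 \<le> h x" "\<And>x. x \<in> {0..1} \<Longrightarrow> h x \<le> 1"
  shows "\<exists>g. \<forall>t. \<bar>t\<bar> \<le> 1 \<longrightarrow>
    mean_log_partition (\<lambda>x. \<tau> x + t * h x) \<le> mean_log_partition \<tau> + t * g + t\<^sup>2"
proof -
  define G where "G x = (\<Sum>j=1..D. exp (\<tau> (V j x)) * h (V j x)) / (\<Sum>j=1..D. exp (\<tau> (V j x)))" for x
  have G_int: "integrable N G"
  proof (rule integrable_const_bound[of _ 1])
    show "AE x in N. norm (G x) \<le> 1"
    proof (rule AE_I2)
      fix x assume x: "x \<in> space N"
      have "0 < (\<Sum>j=1..D. exp (\<tau> (V j x)))" using D by (intro sum_pos) auto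
      moreover have "(\<Sum>j=1..D. exp (\<tau> (V j x)) * h (V j x)) \<le> (\<Sum>j=1..D. exp (\<tau> (V j x)) * 1)"
        using h_bounds V_in_unit x by (intro sum_mono mult_left_mono) auto
      moreover have "0 \<le> (\<Sum>j=1..D. exp (\<tau> (V j x)) * h (V j x))"
        using h_bounds V_in_unit x by (intro sum_nonneg mult_nonneg_nonneg) auto
      ultimately show "norm (G x) \<le> 1" by (simp add: G_def)
    qed
    show "G \<in> borel_measurable N"
      unfolding G_def
      using measurable_compose[OF V_measurable bounded_measurableD(1)[OF \<tau>]]
        measurable_compose[OF V_measurable bounded_measurableD(1)[OF h]] by measurable
  qed
  have "mean_log_partition (\<lambda>x. \<tau> x + t * h x) \<le> mean_log_partition \<tau> + t * expectation G + t\<^sup>2"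
    if t: "\<bar>t\<bar> \<le> 1" for t
  proof -
    have "mean_log_partition (\<lambda>x. \<tau> x + t * h x)
        \<le> expectation (\<lambda>x. log_partition D \<tau> (\<lambda>j. V j x) + t * G x + t\<^sup>2)"
      unfolding mean_log_partition_def
    proof (rule integral_mono)
      show "integrable N (\<lambda>x. log_partition D (\<lambda>x. \<tau> x + t * h x) (\<lambda>j. V j x))"
        by (intro integrable_log_partition bounded_measurable_add bounded_measurable_cmult \<tau> h)
      show "integrable N (\<lambda>x. log_partition D \<tau> (\<lambda>j. V j x) + t * G x + t\<^sup>2)"
        using G_int integrable_log_partition[OF \<tau>] by auto
      show "log_partition D (\<lambda>x. \<tau> x + t * h x) (\<lambda>j. V j x)
          \<le> log_partition D \<tau> (\<lambda>j. V j x) + t * G x + t\<^sup>2" if "x \<in> space N" for x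
        unfolding log_partition_def G_def
        using D h_bounds V_in_unit that t by (intro ln_sum_exp_tilt_le) auto
    qed
    also have "\<dots> = mean_log_partition \<tau> + t * expectation G + t\<^sup>2"
      using G_int integrable_log_partition[OF \<tau>] by (simp add: mean_log_partition_def prob_space)
    finally show ?thesis .
  qed
  then show ?thesis by blast
qed

lemma distr_row:
  "distr N (\<Pi>\<^sub>M j\<in>{1..D}. unit_borel) (\<lambda>x. \<lambda>j\<in>{1..D}. V j x)
    = (\<Pi>\<^sub>M j\<in>{1..D}. distr N unit_borel (V j))"
  using iid D V_measurable
  by (subst indep_vars_iff_distr_eq_PiM'[symmetric]) (auto simp: iid_unif01_def)

end

section \<open>The almost sure limit of the free energy\<close>

theorem free_energy_tendsto:
  fixes U :: "nat \<Rightarrow> nat \<Rightarrow> 'a \<Rightarrow> real"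
  assumes row: "unif_row N D V" and U: "iid_unif01 M (UNIV \<times> {1..D}) (\<lambda>(i, j). U i j)"
    and \<tau>: "\<tau> \<in> bounded_measurable"
  shows "AE \<omega> in M. (\<lambda>n. free_energy D \<tau> (\<lambda>i j. U i j \<omega>) n)
    \<longlonglongrightarrow> unif_row.mean_log_partition N D V \<tau>"
proof -
  interpret R: unif_row N D V by fact
  interpret M: prob_space M using U by (simp add: iid_unif01_def)
  \<comment> \<open>The index block of row i. The blocks are disjoint, so the log-partitions
    \<open>X i\<close>, each a function of its own block, are independent.\<close>
  define K where "K i = {i} \<times> {1..D}" for i :: nat
  define X where "X i \<omega> = log_partition D \<tau> (\<lambda>j. U i j \<omega>)" for i \<omega>
  define F where "F i g = log_partition D \<tau> (\<lambda>j. g (i, j))" for i :: nat and g :: "nat \<times> nat \<Rightarrow> real"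
  have UV: "M.indep_vars (\<lambda>_. unit_borel) (\<lambda>(i, j). U i j) (UNIV \<times> {1..D})"
    using U by (simp add: iid_unif01_def)
  then have U_meas: "U i j \<in> measurable M unit_borel" if "j \<in> {1..D}" for i j
    using that unfolding M.indep_vars_def by force
  have F_meas: "F i \<in> borel_measurable (Pi\<^sub>M (K i) (\<lambda>_. unit_borel))" for i
    unfolding F_def
    by (rule measurable_log_partition[OF bounded_measurableD(1)[OF \<tau>]]) (auto simp: K_def)
  have X_eq: "X i = (\<lambda>\<omega>. F i (\<lambda>p\<in>K i. case p of (i, j) \<Rightarrow> U i j \<omega>))" for i
    unfolding X_def F_def by (auto simp: log_partition_def K_def fun_eq_iff)
  have "M.indep_vars (\<lambda>i. Pi\<^sub>M (K i) (\<lambda>_. unit_borel))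
      (\<lambda>i \<omega>. \<lambda>p\<in>K i. (case p of (i, j) \<Rightarrow> U i j) \<omega>) UNIV"
    by (rule M.indep_vars_restrict[OF UV]) (auto simp: K_def disjoint_family_on_def)
  from M.indep_vars_compose2[OF this F_meas]
  have indep: "M.indep_vars (\<lambda>_. borel) X UNIV"
    unfolding X_eq by (simp add: case_prod_unfold)
  obtain C where C: "\<forall>x\<in>{0..1}. \<bar>\<tau> x\<bar> \<le> C" using bounded_measurableD(2)[OF \<tau>] by blast
  have bound: "\<bar>X i \<omega>\<bar> \<le> C + ln (real D)" if "\<omega> \<in> space M" for i \<omega>
    unfolding X_def using C measurable_space[OF U_meas that]
    by (intro abs_log_partition_le R.D) (simp add: space_restrict_space)
  define Q where "Q = distr N unit_borel (V 1)"
  have Q_U: "distr M unit_borel (U i j) = Q" if "j \<in> {1..D}" for i j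
    unfolding Q_def using R.D that U R.iid
    by (intro distr_unit_borel_eqI U_meas R.V_measurable) (auto simp: iid_unif01_def)
  have Q_V: "distr N unit_borel (V j) = Q" if "j \<in> {1..D}" for j
    unfolding Q_def using R.D that R.iid
    by (intro distr_unit_borel_eqI R.V_measurable) (auto simp: iid_unif01_def)
  interpret Q: prob_space Q
    unfolding Q_def using R.D by (intro R.prob_space_distr R.V_measurable) auto
  have sets_Q: "sets Q = sets unit_borel" by (simp add: Q_def)
  \<comment> \<open>The environment and the row V live on different probability spaces, so the means
    are compared through laws: both rows are distributed as D independent copies of Q, once the
    index (i, j) is renamed j.\<close>
  have mean: "M.expectation (X i) = R.mean_log_partition \<tau>" for i
  proof -
    have F'_meas: "log_partition D \<tau> \<in> borel_measurable (Pi\<^sub>M {1..D} (\<lambda>_. unit_borel))"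
      by (rule measurable_log_partition[OF bounded_measurableD(1)[OF \<tau>]]) auto
    have "distr M (Pi\<^sub>M (K i) (\<lambda>_. unit_borel)) (\<lambda>\<omega>. \<lambda>p\<in>K i. (case p of (i, j) \<Rightarrow> U i j) \<omega>)
        = Pi\<^sub>M (K i) (\<lambda>p. distr M unit_borel (case p of (i, j) \<Rightarrow> U i j))"
      using M.indep_vars_subset[OF UV, of "K i"] R.D U_meas
      by (subst M.indep_vars_iff_distr_eq_PiM'[symmetric]) (auto simp: K_def)
    also have "\<dots> = Pi\<^sub>M (K i) (\<lambda>_. Q)"
      by (rule PiM_cong) (auto simp: K_def Q_U)
    finally have PM: "distr M (Pi\<^sub>M (K i) (\<lambda>_. unit_borel))
        (\<lambda>\<omega>. \<lambda>p\<in>K i. (case p of (i, j) \<Rightarrow> U i j) \<omega>) = Pi\<^sub>M (K i) (\<lambda>_. Q)" .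
    have "distr N (Pi\<^sub>M {1..D} (\<lambda>_. unit_borel)) (\<lambda>x. \<lambda>j\<in>{1..D}. V j x) = Pi\<^sub>M {1..D} (\<lambda>_. Q)"
      unfolding R.distr_row by (rule PiM_cong) (auto simp: Q_V)
    also have "\<dots> = distr (Pi\<^sub>M (K i) (\<lambda>_. Q)) (Pi\<^sub>M {1..D} (\<lambda>_. Q)) (\<lambda>g. \<lambda>j\<in>{1..D}. g (i, j))"
      by (rule distr_PiM_reindex[symmetric]) (auto simp: K_def inj_on_def Q.prob_space_axioms)
    finally have PN: "distr N (Pi\<^sub>M {1..D} (\<lambda>_. unit_borel)) (\<lambda>x. \<lambda>j\<in>{1..D}. V j x)
      = distr (Pi\<^sub>M (K i) (\<lambda>_. Q)) (Pi\<^sub>M {1..D} (\<lambda>_. Q)) (\<lambda>g. \<lambda>j\<in>{1..D}. g (i, j))" .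
    have sQ: "sets (Pi\<^sub>M I (\<lambda>_. Q)) = sets (Pi\<^sub>M I (\<lambda>_. unit_borel))" for I :: "'i set"
      by (rule sets_PiM_cong) (auto simp: sets_Q)
    have lp: "log_partition D \<tau> (\<lambda>j\<in>{1..D}. v j) = log_partition D \<tau> v" for v
      by (simp add: log_partition_def)
    have "M.expectation (X i) = (\<integral>g. F i g \<partial>Pi\<^sub>M (K i) (\<lambda>_. Q))"
      unfolding PM[symmetric] X_eq using U_meas F_meas
      by (subst integral_distr) (auto simp: K_def case_prod_unfold intro!: measurable_restrict)
    also have "\<dots> = (\<integral>g. log_partition D \<tau> (\<lambda>j\<in>{1..D}. g (i, j)) \<partial>Pi\<^sub>M (K i) (\<lambda>_. Q))"
      by (simp only: F_def lp)
    also have "\<dots> = (\<integral>v. log_partition D \<tau> v \<partial>distr (Pi\<^sub>M (K i) (\<lambda>_. Q)) (Pi\<^sub>M {1..D} (\<lambda>_. Q))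
        (\<lambda>g. \<lambda>j\<in>{1..D}. g (i, j)))"
      using F'_meas by (subst integral_distr)
        (auto simp: K_def measurable_cong_sets[OF sQ refl] measurable_cong_sets[OF refl sets_Q]
          intro!: measurable_restrict)
    also have "\<dots> = (\<integral>x. log_partition D \<tau> (\<lambda>j\<in>{1..D}. V j x) \<partial>N)"
      unfolding PN[symmetric] using F'_meas R.V_measurable
      by (subst integral_distr) (auto intro!: measurable_restrict)
    finally show ?thesis by (simp only: lp R.mean_log_partition_def)
  qed
  from M.strong_law_bounded[OF indep bound mean] show ?thesis
    by (simp add: free_energy_eq_average[OF R.D] X_def)
qed

subsection \<open>Empirical measures and the Levy-Prokhorov distance\<close>

lemma unit_borel_sets_iff: "A \<in> sets unit_borel \<longleftrightarrow> A \<in> sets borel \<and> A \<subseteq> {0..1}"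
  by (auto simp: sets_restrict_space_iff)

lemma sets_empirical_measure [simp]: "sets (empirical_measure u n \<pi>) = sets unit_borel"
  unfolding empirical_measure_def path_measure_def
  using sets.sigma_sets_eq[of unit_borel] sets.space_closed[of unit_borel]
  by (simp add: space_restrict_space)

lemma measure_empirical_measure:
  assumes "n > 0" "A \<in> sets unit_borel"
  shows "measure (empirical_measure u n \<pi>) A = (\<Sum>i<n. indicator A (u i (\<pi> i))) / real n"
proof -
  have "emeasure (path_measure u n \<pi>) A = ennreal (\<Sum>i<n. indicator A (u i (\<pi> i)))"
    using assms by (simp add: emeasure_path_measure ennreal_indicator flip: sum_ennreal)
  then have "measure (path_measure u n \<pi>) A = (\<Sum>i<n. indicator A (u i (\<pi> i)))"
    by (simp add: measure_def sum_nonneg)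
  moreover have "(1 / of_nat n :: ennreal) = ennreal (1 / real n)"
    using assms(1) divide_ennreal[of 1 "real n"] by (simp add: ennreal_of_nat_eq_real_of_nat)
  ultimately show ?thesis
    by (simp add: empirical_measure_def measure_scale_measure)
qed

lemma prob_space_empirical_measure:
  assumes "n > 0" "\<And>i. i < n \<Longrightarrow> u i (\<pi> i) \<in> {0..1}"
  shows "prob_space (empirical_measure u n \<pi>)"
proof
  have unit: "{0..1} \<in> sets unit_borel" by (simp add: unit_borel_sets_iff)
  have sp: "space (empirical_measure u n \<pi>) = {0..1}"
    by (simp add: sets_eq_imp_space_eq[OF sets_empirical_measure] space_restrict_space)
  have "emeasure (path_measure u n \<pi>) {0..1} = (\<Sum>i<n. 1)"
    unfolding emeasure_path_measure[OF unit] using assms(2) unit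
    by (intro sum.cong) (auto simp: emeasure_return)
  then show "emeasure (empirical_measure u n \<pi>) (space (empirical_measure u n \<pi>)) = 1"
    unfolding sp using assms(1)
    by (simp add: empirical_measure_def ennreal_divide_times of_nat_less_top)
qed

lemma unit_nbhd_sets: "unit_nbhd e A \<in> sets unit_borel"
proof -
  have "unit_nbhd e A = {0..1} \<inter> (\<Union>x\<in>A. ball x e)"
    by (auto simp: unit_nbhd_def)
  moreover have "open (\<Union>x\<in>A. ball x e)" by blast
  ultimately show ?thesis by (simp add: unit_borel_sets_iff)
qed

lemma unit_nbhd_mono: "d \<le> e \<Longrightarrow> unit_nbhd d A \<subseteq> unit_nbhd e A"
  unfolding unit_nbhd_def by (blast intro: less_le_trans)

lemma levy_prokhorov_le:
  assumes "e > 0"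
    and "\<And>A. A \<in> sets unit_borel \<Longrightarrow> measure \<mu> A \<le> measure \<nu> (unit_nbhd e A) + e"
    and "\<And>A. A \<in> sets unit_borel \<Longrightarrow> measure \<nu> A \<le> measure \<mu> (unit_nbhd e A) + e"
  shows "levy_prokhorov \<mu> \<nu> \<le> e"
  unfolding levy_prokhorov_def
  by (rule cInf_lower) (use assms in \<open>auto intro!: bdd_belowI[of _ 0]\<close>)

text \<open>The radius 1 is always admissible because probabilities are at most 1. Nonemptiness is
  what makes the real infimum in \<open>levy_prokhorov\<close> usable from below.\<close>

lemma levy_prokhorov_set_nonempty:
  assumes "prob_space \<mu>" "prob_space \<nu>"
  shows "{e. e > 0 \<and> (\<forall>A\<in>sets unit_borel.
     measure \<mu> A \<le> measure \<nu> (unit_nbhd e A) + e \<and>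
     measure \<nu> A \<le> measure \<mu> (unit_nbhd e A) + e)} \<noteq> {}"
proof -
  have "measure \<mu> A \<le> measure \<nu> B + 1 \<and> measure \<nu> A \<le> measure \<mu> B + 1" for A B
    using prob_space.prob_le_1[OF assms(1)] prob_space.prob_le_1[OF assms(2)]
    by (smt (verit) measure_nonneg)
  then show ?thesis
    unfolding ex_in_conv[symmetric] by (intro exI[of _ 1]) simp
qed

lemma levy_prokhorov_nonneg:
  assumes "prob_space \<mu>" "prob_space \<nu>"
  shows "0 \<le> levy_prokhorov \<mu> \<nu>"
  unfolding levy_prokhorov_def
  by (rule cInf_greatest[OF levy_prokhorov_set_nonempty[OF assms]]) auto

text \<open>Strictness provides an admissible radius d < e, and neighbourhoods grow with their
  radius.\<close>

lemma levy_prokhorov_lessD: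
  assumes \<mu>: "prob_space \<mu>" "sets \<mu> = sets unit_borel" and \<nu>: "prob_space \<nu>"
    and less: "levy_prokhorov \<mu> \<nu> < e" and A: "A \<in> sets unit_borel"
  shows "measure \<nu> A \<le> measure \<mu> (unit_nbhd e A) + e"
proof -
  interpret prob_space \<mu> by fact
  obtain d where d: "d < e" "measure \<nu> A \<le> measure \<mu> (unit_nbhd d A) + d"
    using cInf_lessD[OF levy_prokhorov_set_nonempty[OF \<mu>(1) \<nu>] less[unfolded levy_prokhorov_def]] A
    by auto
  moreover have "measure \<mu> (unit_nbhd d A) \<le> measure \<mu> (unit_nbhd e A)"
    using d unit_nbhd_mono[of d e A] by (intro finite_measure_mono) (simp_all add: \<mu> unit_nbhd_sets)
  ultimately show ?thesis using d by simp
qed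

section \<open>Discretisation into bins\<close>

definition bin :: "nat \<Rightarrow> real \<Rightarrow> nat" where
  "bin m x = nat \<lfloor>real m * x\<rfloor>"

definition bin_set :: "nat \<Rightarrow> nat \<Rightarrow> real set" where
  "bin_set m k = {x \<in> {0..1}. bin m x = k}"

text \<open>For m > 0 the bins 0, ..., m - 1 have width 1/m and bin m is the single point 1, which
  is why m + 1 bins occur throughout.\<close>

lemma bin_le: "x \<in> {0..1} \<Longrightarrow> bin m x \<le> m"
  using mult_left_le[of x "real m"] unfolding bin_def by (simp add: nat_le_iff floor_le_iff)

lemma bin_eq_imp_close:
  assumes "m > 0" "x \<ge> 0" "y \<ge> 0" "bin m x = bin m y"
  shows "\<bar>x - y\<bar> < 1 / real m"
proof -
  have "\<lfloor>real m * x\<rfloor> = \<lfloor>real m * y\<rfloor>"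
    using assms unfolding bin_def by (subst (asm) eq_nat_nat_iff) auto
  then have "\<bar>real m * x - real m * y\<bar> < 1" by linarith
  then have "real m * \<bar>x - y\<bar> < 1" by (simp add: abs_mult flip: right_diff_distrib)
  then show ?thesis using assms(1) by (simp add: field_simps)
qed

lemma bin_measurable [measurable]: "bin m \<in> measurable borel (count_space UNIV)"
  unfolding bin_def by measurable

lemma bin_set_sets: "bin_set m k \<in> sets unit_borel"
proof -
  have "bin_set m k = {0..1} \<inter> (bin m -` {k} \<inter> space borel)"
    by (auto simp: bin_set_def)
  also have "\<dots> \<in> sets borel"
    by (intro sets.Int measurable_sets[OF bin_measurable]) auto
  finally show ?thesis by (auto simp: unit_borel_sets_iff bin_set_def)
qed

text \<open>Enlarge A to the union of the bins that meet it. This union stays inside the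
  1/m-neighbourhood, and exchanging \<mu> for \<nu> on it costs at most d for each of at most m + 1
  bins.\<close>

lemma measure_le_nbhd_of_bins:
  assumes \<mu>: "prob_space \<mu>" "sets \<mu> = sets unit_borel"
    and \<nu>: "prob_space \<nu>" "sets \<nu> = sets unit_borel" and m: "m > 0"
    and close: "\<And>k. k \<le> m \<Longrightarrow> \<bar>measure \<mu> (bin_set m k) - measure \<nu> (bin_set m k)\<bar> \<le> d"
    and A: "A \<in> sets unit_borel"
  shows "measure \<mu> A \<le> measure \<nu> (unit_nbhd (1 / real m) A) + real (m + 1) * d"
proof -
  interpret \<mu>: prob_space \<mu> by fact
  interpret \<nu>: prob_space \<nu> by fact
  define K where "K = {k. k \<le> m \<and> bin_set m k \<inter> A \<noteq> {}}"
  have K: "finite K" "K \<subseteq> {..m}" by (auto simp: K_def)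
  have Asub: "A \<subseteq> {0..1}" using A by (simp add: unit_borel_sets_iff)
  have disj: "disjoint_family_on (bin_set m) K" by (auto simp: disjoint_family_on_def bin_set_def)
  have d0: "0 \<le> d" using close[of 0] by simp
  have "A \<subseteq> (\<Union>k\<in>K. bin_set m k)"
    using Asub bin_le by (fastforce simp: K_def bin_set_def)
  then have "measure \<mu> A \<le> measure \<mu> (\<Union>k\<in>K. bin_set m k)"
    using K by (intro \<mu>.finite_measure_mono) (auto simp: \<mu> bin_set_sets)
  also have "\<dots> = (\<Sum>k\<in>K. measure \<mu> (bin_set m k))"
    using K disj by (intro \<mu>.finite_measure_finite_Union) (auto simp: \<mu> bin_set_sets)
  also have "\<dots> \<le> (\<Sum>k\<in>K. measure \<nu> (bin_set m k) + d)"
    using close K by (intro sum_mono) (fastforce simp: abs_le_iff)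
  also have "\<dots> = (\<Sum>k\<in>K. measure \<nu> (bin_set m k)) + real (card K) * d"
    by (simp add: sum.distrib)
  also have "(\<Sum>k\<in>K. measure \<nu> (bin_set m k)) = measure \<nu> (\<Union>k\<in>K. bin_set m k)"
    using K disj by (intro \<nu>.finite_measure_finite_Union[symmetric]) (auto simp: \<nu> bin_set_sets)
  also have "\<dots> \<le> measure \<nu> (unit_nbhd (1 / real m) A)"
  proof (rule \<nu>.finite_measure_mono)
    show "(\<Union>k\<in>K. bin_set m k) \<subseteq> unit_nbhd (1 / real m) A"
      using bin_eq_imp_close[OF m] by (fastforce simp: K_def bin_set_def unit_nbhd_def dist_real_def)
  qed (simp add: \<nu> unit_nbhd_sets)
  also have "real (card K) * d \<le> real (m + 1) * d"
    using card_mono[OF _ K(2)] d0 by (intro mult_right_mono) auto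
  finally show ?thesis by simp
qed

lemma levy_prokhorov_le_of_bins:
  assumes "prob_space \<mu>" "sets \<mu> = sets unit_borel" "prob_space \<nu>" "sets \<nu> = sets unit_borel" "m > 0"
    and "\<And>k. k \<le> m \<Longrightarrow> \<bar>measure \<mu> (bin_set m k) - measure \<nu> (bin_set m k)\<bar> \<le> d"
    and "real (m + 1) * d \<le> 1 / real m"
  shows "levy_prokhorov \<mu> \<nu> \<le> 1 / real m"
proof (rule levy_prokhorov_le)
  fix A assume A: "A \<in> sets unit_borel"
  show "measure \<mu> A \<le> measure \<nu> (unit_nbhd (1 / real m) A) + 1 / real m"
    using measure_le_nbhd_of_bins[OF assms(1-6) A] assms(7) by linarith
  have "\<bar>measure \<nu> (bin_set m k) - measure \<mu> (bin_set m k)\<bar> \<le> d" if "k \<le> m" for k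
    using assms(6)[OF that] by (simp add: abs_minus_commute)
  from measure_le_nbhd_of_bins[OF assms(3,4,1,2,5) this A]
  show "measure \<nu> A \<le> measure \<mu> (unit_nbhd (1 / real m) A) + 1 / real m"
    using assms(7) by linarith
qed (use assms in simp)

subsection \<open>Order statistics\<close>

text \<open>Statements about order statistics become statements about counts: sorting changes
  neither the values nor their multiplicities.\<close>

lemma length_filter_sorted_values:
  assumes "finite S"
  shows "length (filter P (sorted_list_of_multiset (image_mset f (mset_set S)))) = card {x \<in> S. P (f x)}"
proof -
  have "length (filter P (sorted_list_of_multiset (image_mset f (mset_set S))))
      = size (filter_mset P (image_mset f (mset_set S)))"
    by (metis mset_filter mset_sorted_list_of_multiset size_mset)
  then show ?thesis using assms by (simp add: filter_mset_image_mset comp_def)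
qed

text \<open>In the sorted list the first k entries are bounded by entry k - 1, so all of them lie
  below e. A value below e also rules out the case k > card S, where the order statistic is
  infinite.\<close>

lemma kth_smallest_lessD:
  assumes S: "finite S" and k: "k \<ge> 1" and less: "kth_smallest k f S < ereal e"
  shows "k \<le> card {x \<in> S. f x < e}"
proof -
  define xs where "xs = sorted_list_of_multiset (image_mset f (mset_set S))"
  have xs: "sorted xs" "length xs = card S"
    using length_filter_sorted_values[OF S, of "\<lambda>_. True" f]
    by (simp_all add: xs_def)
  have kS: "k \<le> card S" and xk: "xs ! (k - 1) < e"
    using less by (auto simp: kth_smallest_def xs_def split: if_splits)
  have "x < e" if "x \<in> set (take k xs)" for x
  proof -
    from that obtain i where i: "i < k" "i < length xs" "x = xs ! i"
      by (auto simp: in_set_conv_nth)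
    then have "xs ! i \<le> xs ! (k - 1)"
      using xs kS k by (intro sorted_nth_mono) auto
    then show ?thesis using i xk by simp
  qed
  then have "filter (\<lambda>y. y < e) (take k xs) = take k xs" by (simp add: filter_id_conv)
  then have "k = length (filter (\<lambda>y. y < e) (take k xs))" using kS xs by simp
  also have "\<dots> \<le> length (filter (\<lambda>y. y < e) (take k xs @ drop k xs))"
    unfolding filter_append by simp
  finally show ?thesis
    using length_filter_sorted_values[OF S, of "\<lambda>y. y < e" f] by (simp add: xs_def)
qed

lemma kth_smallest_leI:
  assumes S: "finite S" and k: "k \<ge> 1" and card: "k \<le> card {x \<in> S. f x \<le> e}"
  shows "kth_smallest k f S \<le> ereal e"
proof -
  define xs where "xs = sorted_list_of_multiset (image_mset f (mset_set S))"
  have xs: "sorted xs" "length xs = card S"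
    using length_filter_sorted_values[OF S, of "\<lambda>_. True" f]
    by (simp_all add: xs_def)
  have kS: "k \<le> card S" using card card_mono[OF S, of "{x \<in> S. f x \<le> e}"] by auto
  have "xs ! (k - 1) \<le> e"
  proof (rule ccontr)
    assume not_le: "\<not> xs ! (k - 1) \<le> e"
    \<comment> \<open>If the entry at index k - 1 exceeds e, so do all later ones. Then only the
      first k - 1 entries can count, fewer than k.\<close>
    have "\<not> x \<le> e" if "x \<in> set (drop (k - 1) xs)" for x
    proof -
      from that obtain i where i: "k - 1 + i < length xs" "x = xs ! (k - 1 + i)"
        by (auto simp: in_set_conv_nth less_diff_conv add.commute)
      then have "xs ! (k - 1) \<le> xs ! (k - 1 + i)"
        using xs by (intro sorted_nth_mono) auto
      then show ?thesis using i not_le by simp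
    qed
    then have "filter (\<lambda>y. y \<le> e) (drop (k - 1) xs) = []" by (simp add: filter_empty_conv)
    then have "length (filter (\<lambda>y. y \<le> e) (take (k - 1) xs @ drop (k - 1) xs))
        = length (filter (\<lambda>y. y \<le> e) (take (k - 1) xs))"
      unfolding filter_append by simp
    also have "\<dots> \<le> length (take (k - 1) xs)" by (rule length_filter_le)
    also have "\<dots> < k" using k by simp
    finally show False
      using length_filter_sorted_values[OF S, of "\<lambda>y. y \<le> e" f] card by (simp add: xs_def)
  qed
  then show ?thesis using kS by (simp add: kth_smallest_def xs_def)
qed

lemma kth_smallest_nonneg:
  assumes S: "finite S" and k: "k \<ge> 1" and nonneg: "\<And>x. x \<in> S \<Longrightarrow> 0 \<le> f x"
  shows "0 \<le> kth_smallest k f S"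
proof (rule ccontr)
  assume "\<not> 0 \<le> kth_smallest k f S"
  then have "kth_smallest k f S < ereal 0" by (simp add: not_le flip: zero_ereal_def)
  from kth_smallest_lessD[OF S k this] have "{x \<in> S. f x < 0} \<noteq> {}"
    using k by (intro notI) simp
  then show False using nonneg by force
qed

subsection \<open>The upper bound on the grid entropy\<close>

lemma finite_paths: "finite (paths D n)"
  unfolding paths_def by (intro finite_PiE) auto

lemma exp_free_energy:
  assumes "D \<ge> 1" "n > 0"
  shows "exp (real n * free_energy D \<tau> u n) = (\<Sum>\<pi>\<in>paths D n. exp (passage_time \<tau> u n \<pi>))"
proof -
  have "paths D n \<noteq> {}" using assms(1) by (auto simp: paths_def PiE_eq_empty_iff)
  then have "0 < (\<Sum>\<pi>\<in>paths D n. exp (passage_time \<tau> u n \<pi>))"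
    using finite_paths by (intro sum_pos) auto
  then show ?thesis using assms(2) by (simp add: free_energy_def)
qed

lemma bounded_measurable_integrable:
  assumes \<nu>: "prob_space \<nu>" "sets \<nu> = sets unit_borel" and \<tau>: "\<tau> \<in> bounded_measurable"
  shows "integrable \<nu> \<tau>"
proof -
  interpret prob_space \<nu> by fact
  obtain C where C: "\<forall>x\<in>{0..1}. \<bar>\<tau> x\<bar> \<le> C" using bounded_measurableD(2)[OF \<tau>] by blast
  have "space \<nu> = {0..1}" using sets_eq_imp_space_eq[OF \<nu>(2)] by (simp add: space_restrict_space)
  then show ?thesis
    using C bounded_measurableD(1)[OF \<tau>]
    by (intro integrable_const_bound[of _ C] AE_I2) (simp_all add: measurable_cong_sets[OF \<nu>(2) refl])
qed

section \<open>Approximation by neighbourhoods of compact sets\<close>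

lemma inner_regular_unit_borel:
  assumes \<nu>: "prob_space \<nu>" "sets \<nu> = sets unit_borel" and A: "A \<in> sets unit_borel" and e: "e > 0"
  shows "\<exists>K\<subseteq>A. compact K \<and> measure \<nu> A \<le> measure \<nu> K + e"
proof (rule ccontr)
  assume contr: "\<not> ?thesis"
  interpret prob_space \<nu> by fact
  \<comment> \<open>Inner regularity is applied on the whole line, to the image of \<nu> under the
    inclusion of [0, 1]; the two measures agree on Borel subsets of the interval.\<close>
  define \<nu>' where "\<nu>' = distr \<nu> borel (\<lambda>x. x)"
  have id: "(\<lambda>x. x) \<in> borel_measurable \<nu>"
    unfolding measurable_cong_sets[OF \<nu>(2) refl] by (intro measurable_restrict_space1) simp
  have sp: "space \<nu> = {0..1}" using sets_eq_imp_space_eq[OF \<nu>(2)] by (simp add: space_restrict_space)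
  interpret \<nu>': prob_space \<nu>' unfolding \<nu>'_def by (rule prob_space_distr[OF id])
  have eq: "emeasure \<nu>' B = ennreal (measure \<nu> B)" if "B \<in> sets borel" "B \<subseteq> {0..1}" for B
    using that unfolding \<nu>'_def by (subst emeasure_distr[OF id]) (simp_all add: sp emeasure_eq_measure Int_absorb2)
  have A': "A \<in> sets borel" "A \<subseteq> {0..1}" using A by (auto simp: unit_borel_sets_iff)
  have lt: "measure \<nu> K < measure \<nu> A - e" if "K \<subseteq> A" "compact K" for K
    using contr that by force
  have "ennreal (measure \<nu> A) = (SUP K\<in>{K. K \<subseteq> A \<and> compact K}. emeasure \<nu>' K)"
    using inner_regular[of \<nu>' A] A' eq[OF A'] by (simp add: \<nu>'_def \<nu>'.emeasure_finite[unfolded \<nu>'_def])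
  also have "\<dots> \<le> ennreal (measure \<nu> A - e)"
  proof (rule SUP_least)
    fix K assume "K \<in> {K. K \<subseteq> A \<and> compact K}"
    then show "emeasure \<nu>' K \<le> ennreal (measure \<nu> A - e)"
      using lt[of K] A' by (subst eq) (auto intro!: ennreal_leI borel_compact)
  qed
  \<comment> \<open>The empty compact set shows that \<open>measure \<nu> A - e\<close> is positive,
    so that \<open>ennreal\<close> does not truncate it to 0 and the comparison contradicts e >
    0.\<close>
  finally show False
    using lt[of "{}"] e by (auto simp: ennreal_le_iff)
qed

text \<open>The neighbourhoods decrease to the closure of K, which is K itself, so the differences
  decrease to the empty set. Continuity from above applies because everything has finite
  length.\<close>

lemma measure_unit_nbhd_diff_tendsto:
  assumes K: "compact K" "K \<subseteq> {0..1}"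
  shows "(\<lambda>n. measure lborel (unit_nbhd (1 / real (Suc n)) K - K)) \<longlonglongrightarrow> 0"
proof -
  define S where "S n = unit_nbhd (1 / real (Suc n)) K" for n
  have S_borel: "S n \<in> sets borel" "S n \<subseteq> {0..1}" for n
    using unit_nbhd_sets unfolding S_def unit_borel_sets_iff by blast+
  have K_borel: "K \<in> sets borel" using K by (simp add: borel_compact)
  have finite: "emeasure lborel B \<noteq> \<infinity>" if "B \<subseteq> {0..1::real}" for B
    using emeasure_mono[OF that, of lborel] by (auto simp: top_unique)
  have "(\<Inter>n. S n - K) = {}"
  proof -
    have "y \<in> K" if y: "\<And>n. y \<in> S n" for y
    proof -
      have "\<exists>x\<in>K. dist x y < e" if "e > 0" for e :: real
      proof -
        obtain n where "1 / real (Suc n) < e" using \<open>e > 0\<close> nat_approx_posE by blast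
        with y[of n] show ?thesis by (force simp: S_def unit_nbhd_def)
      qed
      then have "y \<in> closure K" by (simp add: closure_approachable)
      then show "y \<in> K" using K by (simp add: compact_imp_closed)
    qed
    then show ?thesis by auto
  qed
  moreover have "(\<lambda>n. measure lborel (S n - K)) \<longlonglongrightarrow> measure lborel (\<Inter>n. S n - K)"
  proof (rule Lim_measure_decseq)
    show "range (\<lambda>n. S n - K) \<subseteq> sets lborel" using S_borel K_borel by auto
    have "S n \<subseteq> S m" if "m \<le> n" for m n
      unfolding S_def by (intro unit_nbhd_mono frac_le) (use that in auto)
    then show "decseq (\<lambda>n. S n - K)" unfolding decseq_def by blast
    show "emeasure lborel (S n - K) \<noteq> \<infinity>" for n using S_borel(2)[of n] by (intro finite) auto
  qed
  ultimately show ?thesis unfolding S_def[symmetric] by (simp only: measure_empty)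
qed

text \<open>The count is the floor of y / c. Applied with y = \<tau> x it yields the layer-cake
  approximation of \<tau> from below by indicators of superlevel sets, with error at most c.\<close>

lemma card_multiples_le:
  fixes c y :: real
  assumes "c > 0" "0 \<le> y" "y \<le> real N * c"
  shows "c * real (card {l \<in> {1..N}. real l * c \<le> y}) \<le> y"
    "y \<le> c * real (card {l \<in> {1..N}. real l * c \<le> y}) + c"
proof -
  define q where "q = nat \<lfloor>y / c\<rfloor>"
  have yc: "0 \<le> y / c" "y / c \<le> real N" using assms by (auto simp: field_simps)
  have q: "real q \<le> y / c" "y / c < real q + 1" using yc(1) unfolding q_def by linarith+
  have "real q \<le> real N" using q(1) yc(2) by linarith
  have iff: "real l * c \<le> y \<longleftrightarrow> l \<le> q" for l
  proof -
    have "real l * c \<le> y \<longleftrightarrow> real l \<le> y / c" using assms(1) by (simp add: pos_le_divide_eq)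
    also have "\<dots> \<longleftrightarrow> l \<le> q" unfolding q_def using yc(1) by linarith
    finally show ?thesis .
  qed
  have "{l \<in> {1..N}. l \<le> q} = {1..q}" using \<open>real q \<le> real N\<close> by auto
  then have card: "card {l \<in> {1..N}. real l * c \<le> y} = q" by (simp only: iff) simp
  have "real q * c \<le> y" using q(1) assms(1) by (simp only: pos_le_divide_eq)
  moreover have "y < (real q + 1) * c" using q(2) assms(1) by (simp only: pos_divide_less_eq)
  ultimately show "c * real (card {l \<in> {1..N}. real l * c \<le> y}) \<le> y"
    "y \<le> c * real (card {l \<in> {1..N}. real l * c \<le> y}) + c"
    unfolding card by (simp_all add: algebra_simps)
qed

context unif_row
begin

text \<open>Write \<tau>, up to c, as c times the sum of the indicators of its superlevel sets
  \<open>A l\<close>. Choose compact \<open>K l\<close> inside \<open>A l\<close> carrying nearly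
  all its \<nu>-mass, and let \<sigma> use open neighbourhoods \<open>S l\<close> of
  \<open>K l\<close> instead. Closeness to \<nu> then forces mass on \<open>S l\<close>, while
  \<sigma> exceeds \<tau> only on the short sets \<open>S l - K l\<close>. The choice of \<sigma>
  and e is uniform in the environment, the length and the path.\<close>

lemma lower_approximation_nonneg:
  assumes \<tau>: "\<tau> \<in> bounded_measurable" and C: "C > 0" "\<And>x. x \<in> {0..1} \<Longrightarrow> 0 \<le> \<tau> x \<and> \<tau> x \<le> C"
    and \<nu>: "prob_space \<nu>" "sets \<nu> = sets unit_borel" and \<epsilon>: "\<epsilon> > 0"
  shows "\<exists>\<sigma>\<in>bounded_measurable. \<exists>e>0. mean_log_partition \<sigma> \<le> mean_log_partition \<tau> + \<epsilon> \<and>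
    (\<forall>u n \<pi>. n > 0 \<longrightarrow> (\<forall>i<n. u i (\<pi> i) \<in> {0..1}) \<longrightarrow>
       levy_prokhorov (empirical_measure u n \<pi>) \<nu> < e \<longrightarrow>
       real n * ((\<integral>x. \<tau> x \<partial>\<nu>) - \<epsilon>) \<le> passage_time \<sigma> u n \<pi>)"
proof -
  interpret \<nu>: prob_space \<nu> by fact
  have sp: "space \<nu> = {0..1}" using sets_eq_imp_space_eq[OF \<nu>(2)] by (simp add: space_restrict_space)
  obtain N where N: "N > 0" "C / real N \<le> \<epsilon> / 2"
  proof -
    obtain k where "inverse (real (Suc k)) < \<epsilon> / 2 / C"
      using reals_Archimedean[of "\<epsilon> / 2 / C"] C \<epsilon> by auto
    then have "C / real (Suc k) \<le> \<epsilon> / 2" using C by (simp add: field_simps)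
    then show ?thesis by (intro that[of "Suc k"]) auto
  qed
  define c where "c = C / real N"
  have c: "c > 0" "real N * c = C" using C N by (auto simp: c_def)
  \<comment> \<open>\<eta> bounds four errors: the \<nu>-mass of \<open>A l - K l\<close>, the
    length of \<open>S l - K l\<close>, the radius of the neighbourhoods and the Levy-Prokhorov
    slack. The masses lose at most 2 C \<eta> \<le> \<epsilon> / 2 over all layers, the layer height
    c costs another \<epsilon> / 2, and the lengths raise the mean log-partition by at most D C
    \<eta> = \<epsilon> / 4.\<close>
  define \<eta> where "\<eta> = \<epsilon> / (4 * C * real D)"
  have \<eta>: "\<eta> > 0" using \<epsilon> C D by (auto simp: \<eta>_def)
  have D_eta: "real D * (C * \<eta>) = \<epsilon> / 4" using C D by (simp add: \<eta>_def)
  have C_eta: "C * \<eta> \<le> \<epsilon> / 4"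
  proof -
    have "1 * (C * \<eta>) \<le> real D * (C * \<eta>)" using D C \<eta> by (intro mult_right_mono) auto
    then show ?thesis using D_eta by simp
  qed
  define A where "A l = {x \<in> {0..1}. real l * c \<le> \<tau> x}" for l
  have A_sets: "A l \<in> sets unit_borel" for l
  proof -
    have "A l = {x \<in> space unit_borel. real l * c \<le> \<tau> x}" by (simp add: A_def space_restrict_space)
    moreover have "{x \<in> space unit_borel. real l * c \<le> \<tau> x} \<in> sets unit_borel"
      using bounded_measurableD(1)[OF \<tau>] by measurable
    ultimately show ?thesis by (simp only:)
  qed
  have sum_ind: "(\<Sum>l=1..N. indicator (A l) x) = real (card {l \<in> {1..N}. real l * c \<le> \<tau> x})"
    if "x \<in> {0..1}" for x
    using that by (simp add: A_def indicator_def sum.If_cases Int_def)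
  have layer: "c * (\<Sum>l=1..N. indicator (A l) x) \<le> \<tau> x" "\<tau> x \<le> c * (\<Sum>l=1..N. indicator (A l) x) + c"
    if "x \<in> {0..1}" for x
    using card_multiples_le[of c "\<tau> x" N] C(2)[OF that] c sum_ind[OF that] by auto
  have "\<exists>K\<subseteq>A l. compact K \<and> measure \<nu> (A l) \<le> measure \<nu> K + \<eta>" for l
    by (rule inner_regular_unit_borel[OF \<nu> A_sets \<eta>])
  then obtain K where K: "\<And>l. K l \<subseteq> A l" "\<And>l. compact (K l)"
    "\<And>l. measure \<nu> (A l) \<le> measure \<nu> (K l) + \<eta>"
    by metis
  have K_unit: "K l \<subseteq> {0..1}" for l using K(1)[of l] by (auto simp: A_def)
  have K_sets: "K l \<in> sets unit_borel" for l
    using K_unit K(2) by (simp add: unit_borel_sets_iff borel_compact)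
  \<comment> \<open>One radius has to suit all N layers at once, and it must itself lie below
    \<eta>, since it also enters as the additive Levy-Prokhorov error.\<close>
  have "\<forall>\<^sub>F n in sequentially. \<forall>l\<in>{1..N}. measure lborel (unit_nbhd (1 / real (Suc n)) (K l) - K l) < \<eta>"
    using order_tendstoD(2)[OF measure_unit_nbhd_diff_tendsto[OF K(2) K_unit] \<eta>]
    by (intro eventually_ball_finite) auto
  moreover have "\<forall>\<^sub>F n in sequentially. 1 / real (Suc n) < \<eta>"
    using order_tendstoD(2)[OF LIMSEQ_inverse_real_of_nat \<eta>] by (simp add: inverse_eq_divide)
  ultimately have "\<forall>\<^sub>F n in sequentially. (\<forall>l\<in>{1..N}.
      measure lborel (unit_nbhd (1 / real (Suc n)) (K l) - K l) < \<eta>) \<and> 1 / real (Suc n) < \<eta>"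
    by eventually_elim simp
  then obtain k where k: "\<forall>l\<in>{1..N}. measure lborel (unit_nbhd (1 / real (Suc k)) (K l) - K l) < \<eta>"
    "1 / real (Suc k) < \<eta>"
    by (auto dest: eventually_happens)
  define e where "e = 1 / real (Suc k)"
  have e: "e > 0" "e < \<eta>" "\<And>l. l \<in> {1..N} \<Longrightarrow> measure lborel (unit_nbhd e (K l) - K l) < \<eta>"
    using k by (auto simp: e_def)
  define S where "S l = unit_nbhd e (K l)" for l
  have S_sets: "S l \<in> sets unit_borel" for l by (simp add: S_def unit_nbhd_sets)
  have SK_sets: "S l - K l \<in> sets borel" "S l - K l \<subseteq> {0..1}" for l
    using S_sets[of l] K_sets[of l] by (auto simp: unit_borel_sets_iff)
  define \<sigma> where "\<sigma> x = c * (\<Sum>l=1..N. indicator (S l) x)" for x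
  \<comment> \<open>The possible overshoot of \<sigma> over \<tau>: as \<open>K l\<close> lies in
    \<open>A l\<close>, the indicator of \<open>S l\<close> is at most that of \<open>A l\<close>
    plus that of \<open>S l - K l\<close>.\<close>
  define d where "d x = c * (\<Sum>l=1..N. indicator (S l - K l) x)" for x
  have "S l \<inter> {0..1} = S l" for l using S_sets[of l] by (auto simp: unit_borel_sets_iff)
  then have \<sigma>: "\<sigma> \<in> bounded_measurable"
    unfolding \<sigma>_def
    by (intro bounded_measurable_cmult bounded_measurable_sum bounded_measurable_indicator) (simp add: S_sets)
  have d_meas: "d \<in> borel_measurable borel"
    unfolding d_def using SK_sets by (intro borel_measurable_times borel_measurable_sum) auto
  have d0: "0 \<le> d x" for x unfolding d_def using c by (intro mult_nonneg_nonneg sum_nonneg) auto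
  have dC: "d x \<le> C" for x
  proof -
    have "(\<Sum>l=1..N. indicator (S l - K l) x :: real) \<le> (\<Sum>l=1..N. 1)"
      by (intro sum_mono) (simp add: indicator_def)
    then show ?thesis unfolding d_def using c by (simp add: mult.commute[of _ c] flip: c(2))
  qed
  have d_bm: "d \<in> bounded_measurable"
    using d0 dC d_meas by (intro bounded_measurableI[of _ C] measurable_restrict_space1) auto
  have \<sigma>_le: "\<sigma> x \<le> \<tau> x + d x" if "x \<in> {0..1}" for x
  proof -
    have "\<sigma> x \<le> c * (\<Sum>l=1..N. indicator (A l) x + indicator (S l - K l) x)"
      unfolding \<sigma>_def using c K(1) by (intro mult_left_mono sum_mono) (auto simp: indicator_def)
    also have "\<dots> \<le> \<tau> x + d x"
      using layer(1)[OF that] by (simp add: sum.distrib d_def distrib_left)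
    finally show ?thesis .
  qed
  have "mean_log_partition \<sigma> \<le> mean_log_partition (\<lambda>x. \<tau> x + d x)"
    by (intro mean_log_partition_mono \<sigma> bounded_measurable_add \<tau> d_bm \<sigma>_le)
  also have "\<dots> \<le> mean_log_partition \<tau> + real D * (\<integral>x. d x \<partial>uniform_measure lborel {0..1})"
    by (rule mean_log_partition_add_le[OF \<tau> d_meas d0 dC])
  also have "(\<integral>x. d x \<partial>uniform_measure lborel {0..1}) \<le> C * \<eta>"
  proof -
    interpret L: prob_space "uniform_measure lborel {0..1::real}"
      by (rule prob_space_uniform_measure) auto
    have "(\<integral>x. d x \<partial>uniform_measure lborel {0..1})
        = c * (\<Sum>l=1..N. measure (uniform_measure lborel {0..1}) (S l - K l))"
      unfolding d_def using SK_sets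
      by (simp add: Bochner_Integration.integral_sum L.emeasure_eq_measure)
    also have "\<dots> = c * (\<Sum>l=1..N. measure lborel (S l - K l))"
      using SK_sets by (simp add: measure_uniform_measure Int_absorb1)
    also have "\<dots> \<le> c * (\<Sum>l=1..N. \<eta>)"
      using e(3) c by (intro mult_left_mono sum_mono) (auto simp: S_def less_imp_le)
    also have "\<dots> = C * \<eta>" by (simp flip: c(2))
    finally show ?thesis .
  qed
  also have "real D * (C * \<eta>) \<le> \<epsilon>" using D_eta \<epsilon> by simp
  finally have mean_le: "mean_log_partition \<sigma> \<le> mean_log_partition \<tau> + \<epsilon>"
    by (simp add: mult_left_mono)
  have pass: "real n * ((\<integral>x. \<tau> x \<partial>\<nu>) - \<epsilon>) \<le> passage_time \<sigma> u n \<pi>"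
    if n: "n > 0" and u: "\<forall>i<n. u i (\<pi> i) \<in> {0..1}"
      and lp: "levy_prokhorov (empirical_measure u n \<pi>) \<nu> < e" for u n \<pi>
  proof -
    have prob: "prob_space (empirical_measure u n \<pi>)"
      using n u by (intro prob_space_empirical_measure) auto
    have "(\<integral>x. \<tau> x \<partial>\<nu>) \<le> (\<integral>x. c * (\<Sum>l=1..N. indicator (A l) x) + c \<partial>\<nu>)"
    proof (rule integral_mono)
      show "integrable \<nu> \<tau>" by (rule bounded_measurable_integrable[OF \<nu> \<tau>])
      show "integrable \<nu> (\<lambda>x. c * (\<Sum>l=1..N. indicator (A l) x) + c)"
        using A_sets by (auto simp: \<nu>(2) \<nu>.emeasure_eq_measure)
    qed (use layer sp in auto)
    also have "\<dots> = c * (\<Sum>l=1..N. measure \<nu> (A l)) + c"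
      using A_sets by (simp add: \<nu>(2) \<nu>.emeasure_eq_measure \<nu>.prob_space)
    also have "(\<Sum>l=1..N. measure \<nu> (A l)) \<le> (\<Sum>l=1..N. measure (empirical_measure u n \<pi>) (S l) + 2 * \<eta>)"
    proof (intro sum_mono)
      fix l
      have "measure \<nu> (K l) \<le> measure (empirical_measure u n \<pi>) (S l) + e"
        unfolding S_def by (rule levy_prokhorov_lessD[OF prob _ \<nu>(1) lp K_sets]) simp
      then show "measure \<nu> (A l) \<le> measure (empirical_measure u n \<pi>) (S l) + 2 * \<eta>"
        using K(3)[of l] e by linarith
    qed
    also have "\<dots> = (\<Sum>l=1..N. measure (empirical_measure u n \<pi>) (S l)) + real N * (2 * \<eta>)"
      by (simp add: sum.distrib)
    finally have "(\<integral>x. \<tau> x \<partial>\<nu>)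
        \<le> c * ((\<Sum>l=1..N. measure (empirical_measure u n \<pi>) (S l)) + real N * (2 * \<eta>)) + c"
      using c by simp
    also have "\<dots> = c * (\<Sum>l=1..N. measure (empirical_measure u n \<pi>) (S l)) + 2 * (C * \<eta>) + c"
      by (simp add: distrib_left mult.assoc[symmetric] mult.commute[of c] c(2))
    finally have "(\<integral>x. \<tau> x \<partial>\<nu>) - \<epsilon> \<le> c * (\<Sum>l=1..N. measure (empirical_measure u n \<pi>) (S l))"
      using C_eta N(2) unfolding c_def by linarith
    moreover have "real n * (c * (\<Sum>l=1..N. measure (empirical_measure u n \<pi>) (S l))) = passage_time \<sigma> u n \<pi>"
    proof -
      have "real n * (c * (\<Sum>l=1..N. measure (empirical_measure u n \<pi>) (S l)))
          = c * (\<Sum>l=1..N. \<Sum>i<n. indicator (S l) (u i (\<pi> i)))"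
        using n by (simp add: measure_empirical_measure[OF n S_sets] sum_distrib_left)
      also have "\<dots> = c * (\<Sum>i<n. \<Sum>l=1..N. indicator (S l) (u i (\<pi> i)))"
        by (subst sum.swap) simp
      finally show ?thesis by (simp add: passage_time_def \<sigma>_def sum_distrib_left)
    qed
    ultimately show ?thesis using n by (metis mult_left_mono of_nat_0_le_iff)
  qed
  show ?thesis using \<sigma> e(1) mean_le pass by blast
qed

text \<open>Adding C makes \<tau> nonnegative. The mean log-partition, the integral and the passage
  time per step all shift by the same constant, so the shift can be undone on \<sigma>.\<close>

lemma lower_approximation:
  assumes \<tau>: "\<tau> \<in> bounded_measurable"
    and \<nu>: "prob_space \<nu>" "sets \<nu> = sets unit_borel" and \<epsilon>: "\<epsilon> > 0"
  shows "\<exists>\<sigma>\<in>bounded_measurable. \<exists>e>0. mean_log_partition \<sigma> \<le> mean_log_partition \<tau> + \<epsilon> \<and>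
    (\<forall>u n \<pi>. n > 0 \<longrightarrow> (\<forall>i<n. u i (\<pi> i) \<in> {0..1}) \<longrightarrow>
       levy_prokhorov (empirical_measure u n \<pi>) \<nu> < e \<longrightarrow>
       real n * ((\<integral>x. \<tau> x \<partial>\<nu>) - \<epsilon>) \<le> passage_time \<sigma> u n \<pi>)"
proof -
  interpret \<nu>: prob_space \<nu> by fact
  obtain C where C: "C > 0" "\<forall>x\<in>{0..1}. \<bar>\<tau> x\<bar> \<le> C" using bounded_measurableD(2)[OF \<tau>] by blast
  have \<tau>C: "(\<lambda>x. \<tau> x + C) \<in> bounded_measurable"
    by (intro bounded_measurable_add \<tau> bounded_measurable_const)
  have "0 \<le> \<tau> x + C \<and> \<tau> x + C \<le> 2 * C" if "x \<in> {0..1}" for x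
    using C(2)[rule_format, OF that] by (simp add: abs_le_iff)
  from lower_approximation_nonneg[OF \<tau>C _ this \<nu> \<epsilon>] C(1)
  obtain \<sigma> e where \<sigma>: "\<sigma> \<in> bounded_measurable" and e: "e > 0"
    and mean: "mean_log_partition \<sigma> \<le> mean_log_partition (\<lambda>x. \<tau> x + C) + \<epsilon>"
    and pass: "\<And>u n \<pi>. n > 0 \<Longrightarrow> (\<forall>i<n. u i (\<pi> i) \<in> {0..1}) \<Longrightarrow>
       levy_prokhorov (empirical_measure u n \<pi>) \<nu> < e \<Longrightarrow>
       real n * ((\<integral>x. \<tau> x + C \<partial>\<nu>) - \<epsilon>) \<le> passage_time \<sigma> u n \<pi>"
    by auto
  have int: "(\<integral>x. \<tau> x + C \<partial>\<nu>) = (\<integral>x. \<tau> x \<partial>\<nu>) + C"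
    using bounded_measurable_integrable[OF \<nu> \<tau>] by (simp add: \<nu>.prob_space)
  have pt: "passage_time (\<lambda>x. \<sigma> x + - C) u n \<pi> = passage_time \<sigma> u n \<pi> - real n * C" for u n \<pi>
    by (simp add: passage_time_def sum_subtractf)
  show ?thesis
  proof (intro bexI[of _ "\<lambda>x. \<sigma> x + - C"] exI[of _ e] conjI allI impI)
    show "(\<lambda>x. \<sigma> x + - C) \<in> bounded_measurable"
      by (intro bounded_measurable_add \<sigma> bounded_measurable_const)
    show "mean_log_partition (\<lambda>x. \<sigma> x + - C) \<le> mean_log_partition \<tau> + \<epsilon>"
      using mean unfolding mean_log_partition_add_const[OF \<tau>] mean_log_partition_add_const[OF \<sigma>] by simp
    show "real n * ((\<integral>x. \<tau> x \<partial>\<nu>) - \<epsilon>) \<le> passage_time (\<lambda>x. \<sigma> x + - C) u n \<pi>"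
      if "n > 0" "\<forall>i<n. u i (\<pi> i) \<in> {0..1}" "levy_prokhorov (empirical_measure u n \<pi>) \<nu> < e" for u n \<pi>
      using pass[OF that] unfolding int pt by (simp add: algebra_simps)
  qed (use e in auto)
qed

end

text \<open>Each path within distance e of \<nu> has passage time at least n (I - \<epsilon>) for
  the approximating \<sigma>. Bounding the partition function from below by these paths alone and
  letting n grow compares \<alpha> + I - \<epsilon> with the limit of the free energy.\<close>

lemma grid_rate_le:
  fixes U :: "nat \<Rightarrow> nat \<Rightarrow> 'a \<Rightarrow> real"
  assumes row: "unif_row N D V" and U: "iid_unif01 M (UNIV \<times> {1..D}) (\<lambda>(i, j). U i j)"
    and \<tau>: "\<tau> \<in> bounded_measurable" and \<nu>: "prob_space \<nu>" "sets \<nu> = sets unit_borel"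
    and \<alpha>: "\<alpha> \<ge> 0"
    and lim: "AE \<omega> in M. (\<lambda>n. kth_smallest (nat \<lfloor>exp (\<alpha> * real n)\<rfloor>)
        (\<lambda>\<pi>. levy_prokhorov (empirical_measure (\<lambda>i j. U i j \<omega>) n \<pi>) \<nu>) (paths D n)) \<longlonglongrightarrow> 0"
  shows "\<alpha> \<le> unif_row.mean_log_partition N D V \<tau> - (\<integral>x. \<tau> x \<partial>\<nu>)"
proof -
  interpret R: unif_row N D V by fact
  interpret M: prob_space M using U by (simp add: iid_unif01_def)
  have U_meas: "U i j \<in> measurable M unit_borel" if "j \<in> {1..D}" for i j
    using U that unfolding iid_unif01_def M.indep_vars_def by force
  define I where "I = (\<integral>x. \<tau> x \<partial>\<nu>)"
  have "\<alpha> + I - R.mean_log_partition \<tau> \<le> 2 * \<epsilon>" if \<epsilon>: "\<epsilon> > 0" for \<epsilon>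
  proof -
    obtain \<sigma> e where \<sigma>: "\<sigma> \<in> bounded_measurable" and e: "e > 0"
      and mean: "R.mean_log_partition \<sigma> \<le> R.mean_log_partition \<tau> + \<epsilon>"
      and pass: "\<And>u n \<pi>. n > 0 \<Longrightarrow> (\<forall>i<n. u i (\<pi> i) \<in> {0..1}) \<Longrightarrow>
         levy_prokhorov (empirical_measure u n \<pi>) \<nu> < e \<Longrightarrow>
         real n * (I - \<epsilon>) \<le> passage_time \<sigma> u n \<pi>"
      using R.lower_approximation[OF \<tau> \<nu> \<epsilon>] unfolding I_def by blast
    from lim free_energy_tendsto[OF row U \<sigma>] AE_space
    have "AE \<omega> in M. (\<lambda>n. kth_smallest (nat \<lfloor>exp (\<alpha> * real n)\<rfloor>)
        (\<lambda>\<pi>. levy_prokhorov (empirical_measure (\<lambda>i j. U i j \<omega>) n \<pi>) \<nu>) (paths D n)) \<longlonglongrightarrow> 0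
      \<and> (\<lambda>n. free_energy D \<sigma> (\<lambda>i j. U i j \<omega>) n) \<longlonglongrightarrow> R.mean_log_partition \<sigma> \<and> \<omega> \<in> space M"
      by eventually_elim simp
    \<comment> \<open>The conclusion is deterministic, so a single realisation with both limits is
      enough.\<close>
    from eventually_happens'[OF M.ae_filter_bot this] obtain \<omega> where
      kth: "(\<lambda>n. kth_smallest (nat \<lfloor>exp (\<alpha> * real n)\<rfloor>)
        (\<lambda>\<pi>. levy_prokhorov (empirical_measure (\<lambda>i j. U i j \<omega>) n \<pi>) \<nu>) (paths D n)) \<longlonglongrightarrow> 0"
      and fe: "(\<lambda>n. free_energy D \<sigma> (\<lambda>i j. U i j \<omega>) n) \<longlonglongrightarrow> R.mean_log_partition \<sigma>"
      and \<omega>: "\<omega> \<in> space M"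
      by blast
    define u where "u i j = U i j \<omega>" for i j
    have u: "u i j \<in> {0..1}" if "j \<in> {1..D}" for i j
      using measurable_space[OF U_meas[OF that] \<omega>] by (simp add: u_def space_restrict_space)
    have "\<forall>\<^sub>F n in sequentially. kth_smallest (nat \<lfloor>exp (\<alpha> * real n)\<rfloor>)
        (\<lambda>\<pi>. levy_prokhorov (empirical_measure u n \<pi>) \<nu>) (paths D n) < ereal e"
      using order_tendstoD(2)[OF kth, of "ereal e"] e unfolding u_def by simp
    with eventually_gt_at_top[of 0]
    have "\<forall>\<^sub>F n in sequentially. \<alpha> + I - \<epsilon> - ln 2 / real n \<le> free_energy D \<sigma> u n"
    proof eventually_elim
      case (elim n)
      define k where "k = nat \<lfloor>exp (\<alpha> * real n)\<rfloor>"
      define G where "G = {\<pi> \<in> paths D n. levy_prokhorov (empirical_measure u n \<pi>) \<nu> < e}"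
      have ge1: "1 \<le> exp (\<alpha> * real n)" using \<alpha> by simp
      then have "k \<ge> 1" unfolding k_def by linarith
      from kth_smallest_lessD[OF finite_paths this elim(2)[folded k_def]]
      have "real k \<le> real (card G)" by (simp add: G_def)
      moreover have "exp (\<alpha> * real n) < real k + 1" using ge1 unfolding k_def by linarith
      \<comment> \<open>Taking the floor loses at most a factor 2, because k \<ge> 1 gives k + 1
        \<le> 2 k. This is the ln 2 / n correction, which vanishes in the limit.\<close>
      then have "exp (\<alpha> * real n) / 2 \<le> real k" using \<open>k \<ge> 1\<close> by linarith
      ultimately have G: "exp (\<alpha> * real n) / 2 \<le> real (card G)" by linarith
      have "exp (real n * (\<alpha> + I - \<epsilon> - ln 2 / real n)) = exp (\<alpha> * real n) / 2 * exp (real n * (I - \<epsilon>))"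
      proof -
        have "real n * (\<alpha> + I - \<epsilon> - ln 2 / real n) = \<alpha> * real n - ln 2 + real n * (I - \<epsilon>)"
          using elim(1) by (simp add: algebra_simps)
        then show ?thesis by (simp add: exp_add exp_diff)
      qed
      also have "\<dots> \<le> real (card G) * exp (real n * (I - \<epsilon>))" using G by (intro mult_right_mono) auto
      also have "\<dots> = (\<Sum>\<pi>\<in>G. exp (real n * (I - \<epsilon>)))" by simp
      also have "\<dots> \<le> (\<Sum>\<pi>\<in>G. exp (passage_time \<sigma> u n \<pi>))"
      proof (rule sum_mono)
        fix \<pi> assume "\<pi> \<in> G"
        then have "\<forall>i<n. u i (\<pi> i) \<in> {0..1}" "levy_prokhorov (empirical_measure u n \<pi>) \<nu> < e"
          using u by (auto simp: G_def paths_def simp del: atLeastAtMost_iff)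
        from pass[OF elim(1) this] show "exp (real n * (I - \<epsilon>)) \<le> exp (passage_time \<sigma> u n \<pi>)" by simp
      qed
      also have "\<dots> \<le> (\<Sum>\<pi>\<in>paths D n. exp (passage_time \<sigma> u n \<pi>))"
        using finite_paths by (intro sum_mono2) (auto simp: G_def)
      also have "\<dots> = exp (real n * free_energy D \<sigma> u n)"
        using exp_free_energy[OF R.D elim(1)] by simp
      finally show ?case using elim(1) by simp
    qed
    note bound = this
    have "(\<lambda>n. \<alpha> + I - \<epsilon> - ln 2 / real n) \<longlonglongrightarrow> \<alpha> + I - \<epsilon> - 0"
      by (rule tendsto_diff[OF tendsto_const lim_const_over_n])
    from tendsto_le[OF sequentially_bot fe[folded u_def] this bound]
    have "\<alpha> + I - \<epsilon> \<le> R.mean_log_partition \<sigma>" by simp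
    then show ?thesis using mean by simp
  qed
  note * = this
  have "\<alpha> + I - R.mean_log_partition \<tau> \<le> 0 + \<epsilon>" if "\<epsilon> > 0" for \<epsilon>
    using *[of "\<epsilon> / 2"] that by simp
  then show ?thesis using field_le_epsilon[of "\<alpha> + I - R.mean_log_partition \<tau>" 0] by (simp add: I_def)
qed

subsection \<open>The lower bound on the grid entropy\<close>

text \<open>Minimise J, which is L minus the pairing with p plus (\<delta> / 2) times the squared
  norm of w. The penalty keeps near-minimisers under control though L itself need not be coercive.
  Near-minimality forces g - p + \<delta> w to be small in every coordinate, and both the closeness
  of g to p and the bound on L w minus the pairing with g follow.\<close>

lemma approximate_critical_point:
  fixes L :: "(nat \<Rightarrow> real) \<Rightarrow> real" and p :: "nat \<Rightarrow> real"
  assumes tilt: "\<And>w k. k \<le> m \<Longrightarrow>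
      \<exists>g. \<forall>t. \<bar>t\<bar> \<le> 1 \<longrightarrow> L (w(k := w k + t)) \<le> L w + t * g + t\<^sup>2"
    and lower: "\<And>w. \<beta> \<le> L w - (\<Sum>k\<le>m. w k * p k)"
    and \<epsilon>: "\<epsilon> > 0"
  shows "\<exists>w g. (\<forall>k\<le>m. \<forall>t. \<bar>t\<bar> \<le> 1 \<longrightarrow> L (w(k := w k + t)) \<le> L w + t * g k + t\<^sup>2)
    \<and> (\<forall>k\<le>m. \<bar>g k - p k\<bar> \<le> \<epsilon>) \<and> \<beta> - \<epsilon> \<le> L w - (\<Sum>k\<le>m. w k * g k)"
proof -
  \<comment> \<open>An a priori bound on the penalty at w: comparison with the zero vector gives
    \<open>J w\<close> \<le> L 0 + 1, and \<open>J w\<close> is at least \<beta> plus the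
    penalty.\<close>
  define c where "c = L (\<lambda>_. 0) + 1 - \<beta>"
  have c: "c \<ge> 1" using lower[of "\<lambda>_. 0"] by (simp add: c_def)
  \<comment> \<open>Chosen so that penalty at most c implies (\<delta> w_k)^2 \<le> 2 \<delta> c
    \<le> (\<epsilon> / 2)^2.\<close>
  define \<delta> where "\<delta> = min 1 (\<epsilon>\<^sup>2 / (8 * c))"
  have \<delta>: "\<delta> > 0" "\<delta> \<le> 1" "\<delta> \<le> \<epsilon>\<^sup>2 / (8 * c)" using \<epsilon> c by (auto simp: \<delta>_def)
  have \<delta>c: "2 * \<delta> * c \<le> (\<epsilon> / 2)\<^sup>2"
    using \<delta>(3) c by (simp add: field_simps power2_eq_square)
  \<comment> \<open>The three bounds serve, in this order, s^2 \<le> s, the residual estimate 3 s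
    \<le> \<epsilon> / 2, and the total error (m + 1) 9 s / (4 \<delta>) \<le> \<epsilon>.\<close>
  define s where "s = min 1 (min (\<epsilon> / 6) (4 * \<delta> * \<epsilon> / (9 * real (m + 1))))"
  have s: "s > 0" "s \<le> 1" "s \<le> \<epsilon> / 6" "s \<le> 4 * \<delta> * \<epsilon> / (9 * real (m + 1))"
    using \<epsilon> \<delta> by (auto simp: s_def)
  have s2: "s\<^sup>2 \<le> s" using s(1,2) by (simp add: power2_eq_square mult_left_le)
  define J where "J w = L w - (\<Sum>k\<le>m. w k * p k) + \<delta> / 2 * (\<Sum>k\<le>m. (w k)\<^sup>2)" for w
  have J_lower: "\<beta> + \<delta> / 2 * (\<Sum>k\<le>m. (w k)\<^sup>2) \<le> J w" for w using lower[of w] by (simp add: J_def)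
  have "\<beta> \<le> J w" for w
  proof -
    have "0 \<le> \<delta> / 2 * (\<Sum>k\<le>m. (w k)\<^sup>2)" using \<delta> by (intro mult_nonneg_nonneg sum_nonneg) auto
    then show ?thesis using J_lower[of w] by linarith
  qed
  then have bdd: "bdd_below (range J)" by (auto intro!: bdd_belowI)
  \<comment> \<open>A minimiser need not exist, so w is only optimal up to s^2. This matches the
    quadratic error of a step of size s.\<close>
  have "\<exists>y\<in>range J. y < Inf (range J) + s\<^sup>2"
    using s by (intro cInf_lessD) auto
  then obtain w where w: "J w < Inf (range J) + s\<^sup>2" by blast
  have near: "J w < J w' + s\<^sup>2" for w'
    using w cInf_lower[OF _ bdd, of "J w'"] by fastforce
  have "J w \<le> L (\<lambda>_. 0) + 1" using near[of "\<lambda>_. 0"] s2 s by (simp add: J_def)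
  then have norm: "\<delta> / 2 * (\<Sum>k\<le>m. (w k)\<^sup>2) \<le> c" using J_lower[of w] by (simp add: c_def)
  have \<delta>w: "\<bar>\<delta> * w k\<bar> \<le> \<epsilon> / 2" if "k \<le> m" for k
  proof -
    have "\<delta> / 2 * (w k)\<^sup>2 \<le> \<delta> / 2 * (\<Sum>k\<le>m. (w k)\<^sup>2)"
      using that \<delta> by (intro mult_left_mono member_le_sum) auto
    then have "\<delta> * (w k)\<^sup>2 \<le> 2 * c" using norm by linarith
    then have "\<delta> * (\<delta> * (w k)\<^sup>2) \<le> \<delta> * (2 * c)" using \<delta> by (intro mult_left_mono) auto
    then have "(\<delta> * w k)\<^sup>2 \<le> (\<epsilon> / 2)\<^sup>2"
      using \<delta>c by (simp add: power2_eq_square algebra_simps)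
    then show ?thesis using abs_le_square_iff[of "\<delta> * w k" "\<epsilon> / 2"] \<epsilon> by simp
  qed
  have "\<forall>k. \<exists>g. k \<le> m \<longrightarrow> (\<forall>t. \<bar>t\<bar> \<le> 1 \<longrightarrow> L (w(k := w k + t)) \<le> L w + t * g + t\<^sup>2)"
    using tilt by blast
  then obtain g where g: "\<And>k t. k \<le> m \<Longrightarrow> \<bar>t\<bar> \<le> 1 \<Longrightarrow> L (w(k := w k + t)) \<le> L w + t * g k + t\<^sup>2"
    by metis
  \<comment> \<open>The slope of J at w in coordinate k; it would vanish at an exact
    minimiser.\<close>
  define r where "r k = g k - p k + \<delta> * w k" for k
  have step: "- s\<^sup>2 \<le> t * r k + 2 * t\<^sup>2" if k: "k \<le> m" and t: "\<bar>t\<bar> \<le> 1" for k t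
  proof -
    have upd: "(\<Sum>i\<le>m. F i ((w(k := w k + t)) i)) = (\<Sum>i\<le>m. F i (w i)) + F k (w k + t) - F k (w k)"
      for F :: "nat \<Rightarrow> real \<Rightarrow> real"
      using k by (simp add: sum.remove[of "{..m}" k])
    have "J (w(k := w k + t)) = L (w(k := w k + t)) - ((\<Sum>k\<le>m. w k * p k) + (w k + t) * p k - w k * p k)
        + \<delta> / 2 * ((\<Sum>k\<le>m. (w k)\<^sup>2) + (w k + t)\<^sup>2 - (w k)\<^sup>2)"
      unfolding J_def upd[of "\<lambda>i x. x * p i"] upd[of "\<lambda>i x. x\<^sup>2"] ..
    also have "\<dots> \<le> J w + t * r k + (1 + \<delta> / 2) * t\<^sup>2"
      using g[OF k t] by (simp add: J_def r_def algebra_simps power2_eq_square)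
    also have "(1 + \<delta> / 2) * t\<^sup>2 \<le> 2 * t\<^sup>2" using \<delta> by (intro mult_right_mono) auto
    finally show ?thesis using near[of "w(k := w k + t)"] by linarith
  qed
  \<comment> \<open>Moving coordinate k by s and by -s can lower J by at most s^2, while the
    second-order error is at most 2 s^2.\<close>
  have r: "\<bar>r k\<bar> \<le> 3 * s" if "k \<le> m" for k
  proof -
    have "- s\<^sup>2 \<le> s * r k + 2 * s\<^sup>2" "- s\<^sup>2 \<le> - s * r k + 2 * s\<^sup>2"
      using step[OF that, of s] step[OF that, of "- s"] s by auto
    then have "s * r k \<le> s * (3 * s)" "s * (- r k) \<le> s * (3 * s)"
      by (auto simp: power2_eq_square algebra_simps)
    then have "r k \<le> 3 * s" "- r k \<le> 3 * s"
      using s(1) by (simp_all only: mult_le_cancel_left_pos)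
    then show ?thesis by simp
  qed
  have gp: "\<bar>g k - p k\<bar> \<le> \<epsilon>" if "k \<le> m" for k
    using r[OF that] \<delta>w[OF that] s(3) unfolding r_def by linarith
  have "(\<Sum>k\<le>m. w k * (p k - g k)) \<ge> (\<Sum>k\<le>m. - (9 * s / (4 * \<delta>)))"
  proof (rule sum_mono)
    fix k assume "k \<in> {..m}"
    then have rk: "(r k)\<^sup>2 \<le> 9 * s"
    proof -
      have "\<bar>r k\<bar> \<le> \<bar>3 * s\<bar>" using r[of k] \<open>k \<in> {..m}\<close> s by simp
      then have "(r k)\<^sup>2 \<le> (3 * s)\<^sup>2" by (simp only: abs_le_square_iff)
      also have "\<dots> = 9 * s\<^sup>2" by (simp add: power2_eq_square)
      finally show ?thesis using s2 by simp
    qed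
    \<comment> \<open>Since p - g = \<delta> w - r, the term w (p - g) is the quadratic \<delta> w^2
      - w r. Completing the square bounds it below by -r^2 / (4 \<delta>), whatever the size of
      w.\<close>
    have "0 \<le> (2 * \<delta> * w k - r k)\<^sup>2" by simp
    then have "- (r k)\<^sup>2 \<le> 4 * \<delta> * (\<delta> * (w k)\<^sup>2 - w k * r k)"
      by (simp add: power2_eq_square algebra_simps)
    then have "- (9 * s) \<le> (\<delta> * (w k)\<^sup>2 - w k * r k) * (4 * \<delta>)" using rk by (simp add: algebra_simps)
    then have "- (9 * s) / (4 * \<delta>) \<le> \<delta> * (w k)\<^sup>2 - w k * r k"
      using \<delta>(1) by (subst pos_divide_le_eq) simp_all
    also have "\<dots> = w k * (p k - g k)" by (simp add: r_def power2_eq_square algebra_simps)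
    finally show "- (9 * s / (4 * \<delta>)) \<le> w k * (p k - g k)" by simp
  qed
  moreover have "(\<Sum>k\<le>m. - (9 * s / (4 * \<delta>))) \<ge> - \<epsilon>"
  proof -
    have "real (m + 1) * (9 * s) \<le> 4 * \<delta> * \<epsilon>"
      using s(4) by (simp add: pos_le_divide_eq mult.commute mult.left_commute)
    then have "real (m + 1) * (9 * s / (4 * \<delta>)) \<le> \<epsilon>"
      using \<delta>(1) by (simp add: pos_divide_le_eq mult.commute mult.left_commute)
    then show ?thesis by simp
  qed
  moreover have "(\<Sum>k\<le>m. w k * (p k - g k)) = (\<Sum>k\<le>m. w k * p k) - (\<Sum>k\<le>m. w k * g k)"
    by (simp add: right_diff_distrib sum_subtractf)
  ultimately have "\<beta> - \<epsilon> \<le> L w - (\<Sum>k\<le>m. w k * g k)" using lower[of w] by linarith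
  then show ?thesis using g gp by blast
qed

text \<open>Exponential tilting: on the deviation event the weight gained by adding t h to \<tau> is
  at least exp (n (t g + |t| \<epsilon>)), so the Gibbs mass of the event is bounded by a ratio of
  partition functions. The ratio decays because the log-partition grows by at most t g + t^2 and t^2
  < |t| \<epsilon>. The sign of t selects the upper or the lower tail.\<close>

lemma chernoff_paths:
  assumes D: "D \<ge> 1"
    and fe: "(\<lambda>n. free_energy D \<tau> u n) \<longlonglongrightarrow> a"
    and fe_t: "(\<lambda>n. free_energy D (\<lambda>x. \<tau> x + t * h x) u n) \<longlonglongrightarrow> b"
    and b: "b \<le> a + t * g + t\<^sup>2" and t: "t \<noteq> 0" "\<bar>t\<bar> < \<epsilon>" and c: "c > 0"
  shows "\<forall>\<^sub>F n in sequentially.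
    (\<Sum>\<pi>\<in>{\<pi>\<in>paths D n. t * (passage_time h u n \<pi> / real n - g) > \<bar>t\<bar> * \<epsilon>}. exp (passage_time \<tau> u n \<pi>))
      \<le> c * (\<Sum>\<pi>\<in>paths D n. exp (passage_time \<tau> u n \<pi>))"
proof -
  \<comment> \<open>The exponential rate of the bound on the relative mass; its limit is at most
    -\<gamma>, so it is eventually below -\<gamma> / 2.\<close>
  define q where "q n = free_energy D (\<lambda>x. \<tau> x + t * h x) u n - free_energy D \<tau> u n - (t * g + \<bar>t\<bar> * \<epsilon>)" for n
  define \<gamma> where "\<gamma> = \<bar>t\<bar> * \<epsilon> - t\<^sup>2"
  have "\<bar>t\<bar> * \<bar>t\<bar> < \<bar>t\<bar> * \<epsilon>" using t by (intro mult_strict_left_mono) auto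
  then have \<gamma>: "\<gamma> > 0" by (simp add: \<gamma>_def power2_eq_square)
  have "q \<longlonglongrightarrow> b - a - (t * g + \<bar>t\<bar> * \<epsilon>)" unfolding q_def by (intro tendsto_intros fe fe_t)
  moreover have "b - a - (t * g + \<bar>t\<bar> * \<epsilon>) \<le> - \<gamma>" using b by (simp add: \<gamma>_def)
  then have "b - a - (t * g + \<bar>t\<bar> * \<epsilon>) < - \<gamma> / 2" using \<gamma> by simp
  ultimately have "\<forall>\<^sub>F n in sequentially. q n < - \<gamma> / 2" by (rule order_tendstoD)
  moreover have "\<forall>\<^sub>F n in sequentially. real n * (\<gamma> / 2) > - ln c"
    using \<gamma> by (intro filterlim_at_top_dense[THEN iffD1, rule_format]
        filterlim_at_top_mult_tendsto_pos[OF tendsto_const] filterlim_real_sequentially) auto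
  ultimately show ?thesis using eventually_gt_at_top[of 0]
  proof eventually_elim
    case (elim n)
    define B where "B = {\<pi>\<in>paths D n. t * (passage_time h u n \<pi> / real n - g) > \<bar>t\<bar> * \<epsilon>}"
    have B: "B \<subseteq> paths D n" by (auto simp: B_def)
    have "(\<Sum>\<pi>\<in>B. exp (passage_time \<tau> u n \<pi>))
        \<le> (\<Sum>\<pi>\<in>B. exp (- (real n * (t * g + \<bar>t\<bar> * \<epsilon>))) * exp (passage_time (\<lambda>x. \<tau> x + t * h x) u n \<pi>))"
    proof (rule sum_mono)
      fix \<pi> assume "\<pi> \<in> B"
      then have "t * g + \<bar>t\<bar> * \<epsilon> \<le> t * passage_time h u n \<pi> / real n"
        by (simp add: B_def right_diff_distrib)
      then have "real n * (t * g + \<bar>t\<bar> * \<epsilon>) \<le> t * passage_time h u n \<pi>"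
        using elim by (simp add: pos_le_divide_eq mult.commute)
      moreover have "passage_time (\<lambda>x. \<tau> x + t * h x) u n \<pi> = passage_time \<tau> u n \<pi> + t * passage_time h u n \<pi>"
        by (simp add: passage_time_def sum.distrib sum_distrib_left)
      ultimately show "exp (passage_time \<tau> u n \<pi>)
          \<le> exp (- (real n * (t * g + \<bar>t\<bar> * \<epsilon>))) * exp (passage_time (\<lambda>x. \<tau> x + t * h x) u n \<pi>)"
        by (simp flip: exp_add)
    qed
    also have "\<dots> \<le> (\<Sum>\<pi>\<in>paths D n. exp (- (real n * (t * g + \<bar>t\<bar> * \<epsilon>)))
        * exp (passage_time (\<lambda>x. \<tau> x + t * h x) u n \<pi>))"
      using B finite_paths by (intro sum_mono2) auto
    also have "\<dots> = exp (- (real n * (t * g + \<bar>t\<bar> * \<epsilon>)))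
        * exp (real n * free_energy D (\<lambda>x. \<tau> x + t * h x) u n)"
      using elim by (simp add: exp_free_energy[OF D] sum_distrib_left)
    also have "\<dots> = exp (real n * q n) * exp (real n * free_energy D \<tau> u n)"
      by (simp add: q_def algebra_simps flip: exp_add)
    also have "exp (real n * q n) \<le> c"
    proof -
      have "real n * q n \<le> real n * (- \<gamma> / 2)" using elim by (intro mult_left_mono) auto
      also have "\<dots> \<le> ln c" using elim by simp
      finally show ?thesis using c by (simp add: ln_ge_iff)
    qed
    also have "exp (real n * free_energy D \<tau> u n) = (\<Sum>\<pi>\<in>paths D n. exp (passage_time \<tau> u n \<pi>))"
      using elim by (simp add: exp_free_energy[OF D])
    finally show ?case by (simp add: B_def mult_right_mono)
  qed
qed

section \<open>Step functions over the bins\<close>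

definition step_fun :: "nat \<Rightarrow> (nat \<Rightarrow> real) \<Rightarrow> real \<Rightarrow> real" where
  "step_fun m w x = (\<Sum>k\<le>m. w k * indicator (bin_set m k) x)"

lemma bounded_measurable_bin_set: "indicator (bin_set m k) \<in> bounded_measurable"
proof (rule bounded_measurable_indicator)
  have "bin_set m k \<inter> {0..1} = bin_set m k" by (auto simp: bin_set_def)
  then show "bin_set m k \<inter> {0..1} \<in> sets unit_borel" by (simp add: bin_set_sets)
qed

lemma bounded_measurable_step_fun: "step_fun m w \<in> bounded_measurable"
  unfolding step_fun_def
  by (intro bounded_measurable_sum bounded_measurable_cmult bounded_measurable_bin_set)

text \<open>Perturbing one weight is tilting by one bin indicator. This turns the directional
  estimates for \<tau> into coordinate estimates for w.\<close>

lemma step_fun_update: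
  assumes "k \<le> m"
  shows "step_fun m (w(k := w k + t)) = (\<lambda>x. step_fun m w x + t * indicator (bin_set m k) x)"
proof
  fix x
  have "step_fun m (w(k := w k + t)) x
      = (\<Sum>i\<le>m. w i * indicator (bin_set m i) x + (if i = k then t * indicator (bin_set m k) x else 0))"
    unfolding step_fun_def by (intro sum.cong) (auto simp: distrib_right)
  also have "\<dots> = step_fun m w x + t * indicator (bin_set m k) x"
    using assms by (simp add: sum.distrib step_fun_def)
  finally show "step_fun m (w(k := w k + t)) x = step_fun m w x + t * indicator (bin_set m k) x" .
qed

lemma integral_step_fun:
  assumes \<nu>: "prob_space \<nu>" "sets \<nu> = sets unit_borel"
  shows "(\<integral>x. step_fun m w x \<partial>\<nu>) = (\<Sum>k\<le>m. w k * measure \<nu> (bin_set m k))"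
proof -
  interpret prob_space \<nu> by fact
  have "(\<integral>x. step_fun m w x \<partial>\<nu>) = (\<Sum>k\<le>m. \<integral>x. w k * indicator (bin_set m k) x \<partial>\<nu>)"
    unfolding step_fun_def using \<nu>(2)
    by (intro Bochner_Integration.integral_sum) (simp add: bin_set_sets emeasure_eq_measure)
  then show ?thesis using \<nu>(2) by (simp add: bin_set_sets emeasure_eq_measure)
qed

lemma passage_time_bin:
  assumes "n > 0"
  shows "passage_time (indicator (bin_set m k)) u n \<pi> / real n = measure (empirical_measure u n \<pi>) (bin_set m k)"
  using assms by (simp add: passage_time_def measure_empirical_measure bin_set_sets)

lemma passage_time_step_fun:
  assumes "n > 0"
  shows "passage_time (step_fun m w) u n \<pi>
    = real n * (\<Sum>k\<le>m. w k * measure (empirical_measure u n \<pi>) (bin_set m k))"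
proof -
  have "passage_time (step_fun m w) u n \<pi> = (\<Sum>k\<le>m. w k * passage_time (indicator (bin_set m k)) u n \<pi>)"
    unfolding passage_time_def step_fun_def by (subst sum.swap) (simp add: sum_distrib_left)
  also have "\<dots> = (\<Sum>k\<le>m. w k * (real n * measure (empirical_measure u n \<pi>) (bin_set m k)))"
    using assms by (intro sum.cong refl) (simp flip: passage_time_bin[OF assms])
  finally show ?thesis by (simp add: sum_distrib_left mult_ac)
qed

text \<open>Mass turns into a count: at least half of the partition function comes from paths whose
  bin frequencies are within \<epsilon> of g, and on these paths the weights are nearly constant.
  Dividing the mass by the largest such weight bounds their number from below.\<close>

lemma many_paths_near_critical:
  fixes m :: nat
  assumes D: "D \<ge> 1" and \<epsilon>: "\<epsilon> > 0"
    and t: "0 < t" "t < \<epsilon>"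
    and fe: "(\<lambda>n. free_energy D (step_fun m w) u n) \<longlonglongrightarrow> L w"
    and fe_t: "\<And>k s. k \<le> m \<Longrightarrow> s \<in> {t, - t} \<Longrightarrow>
       (\<lambda>n. free_energy D (step_fun m (w(k := w k + s))) u n) \<longlonglongrightarrow> L (w(k := w k + s))"
    and tilt: "\<And>k s. k \<le> m \<Longrightarrow> s \<in> {t, - t} \<Longrightarrow> L (w(k := w k + s)) \<le> L w + s * g k + s\<^sup>2"
  shows "\<forall>\<^sub>F n in sequentially.
    exp (real n * (free_energy D (step_fun m w) u n - (\<Sum>k\<le>m. w k * g k) - \<epsilon> * (\<Sum>k\<le>m. \<bar>w k\<bar>))) / 2
      \<le> real (card {\<pi>\<in>paths D n. \<forall>k\<le>m. \<bar>measure (empirical_measure u n \<pi>) (bin_set m k) - g k\<bar> \<le> \<epsilon>})"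
proof -
  \<comment> \<open>There are 2 (m + 1) bad events, an upper and a lower tail for each bin; together
    they carry at most half of the mass.\<close>
  define c where "c = 1 / (4 * real (m + 1))"
  define B where "B n k s = {\<pi>\<in>paths D n.
      s * (measure (empirical_measure u n \<pi>) (bin_set m k) - g k) > \<bar>s\<bar> * \<epsilon>}" for n k s
  define Z where "Z n = (\<Sum>\<pi>\<in>paths D n. exp (passage_time (step_fun m w) u n \<pi>))" for n
  have "\<forall>\<^sub>F n in sequentially. (\<Sum>\<pi>\<in>B n k s. exp (passage_time (step_fun m w) u n \<pi>)) \<le> c * Z n"
    if ks: "k \<le> m" "s \<in> {t, - t}" for k s
  proof -
    have s: "s \<noteq> 0" "\<bar>s\<bar> < \<epsilon>" using ks t by auto
    have "c > 0" by (simp add: c_def)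
    from chernoff_paths[OF D fe fe_t[OF ks, unfolded step_fun_update[OF ks(1)]] tilt[OF ks] s this]
      eventually_gt_at_top[of 0]
    show ?thesis
      by eventually_elim (simp add: B_def Z_def passage_time_bin)
  qed
  then have "\<forall>\<^sub>F n in sequentially. \<forall>(k, s)\<in>{..m} \<times> {t, - t}.
      (\<Sum>\<pi>\<in>B n k s. exp (passage_time (step_fun m w) u n \<pi>)) \<le> c * Z n"
    by (intro eventually_ball_finite) auto
  then show ?thesis using eventually_gt_at_top[of 0]
  proof eventually_elim
    case (elim n)
    define E where "E \<pi> = exp (passage_time (step_fun m w) u n \<pi>)" for \<pi>
    define G where "G = {\<pi>\<in>paths D n. \<forall>k\<le>m. \<bar>measure (empirical_measure u n \<pi>) (bin_set m k) - g k\<bar> \<le> \<epsilon>}"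
    have E0: "E \<pi> \<ge> 0" for \<pi> by (simp add: E_def)
    have fin: "finite G" "finite (B n k s)" for k s using finite_paths by (auto simp: G_def B_def)
    have "\<pi> \<in> (\<Union>k\<le>m. B n k t \<union> B n k (- t))" if "\<pi> \<in> paths D n" "\<pi> \<notin> G" for \<pi>
    proof -
      from that obtain k where k: "k \<le> m"
        and "\<epsilon> < \<bar>measure (empirical_measure u n \<pi>) (bin_set m k) - g k\<bar>" (is "_ < \<bar>?y\<bar>")
        by (auto simp: G_def)
      then have "t * \<epsilon> < t * \<bar>?y\<bar>" using t by (intro mult_strict_left_mono) auto
      then have "\<bar>t\<bar> * \<epsilon> < t * ?y \<or> \<bar>t\<bar> * \<epsilon> < - t * ?y"
      proof -
        have "t * \<bar>?y\<bar> = t * ?y \<or> t * \<bar>?y\<bar> = - t * ?y" by (simp add: abs_if algebra_simps)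
        then show ?thesis using \<open>t * \<epsilon> < t * \<bar>?y\<bar>\<close> t(1) by fastforce
      qed
      then have "\<pi> \<in> B n k t \<or> \<pi> \<in> B n k (- t)"
        using that(1) by (simp add: B_def)
      then show ?thesis using k by blast
    qed
    then have "paths D n \<subseteq> G \<union> (\<Union>k\<le>m. B n k t \<union> B n k (- t))" by blast
    then have "Z n \<le> sum E (G \<union> (\<Union>k\<le>m. B n k t \<union> B n k (- t)))"
      unfolding Z_def E_def using fin by (intro sum_mono2) auto
    also have "\<dots> \<le> sum E G + sum E (\<Union>k\<le>m. B n k t \<union> B n k (- t))"
      using fin E0 by (intro sum_Un_le) auto
    also have "sum E (\<Union>k\<le>m. B n k t \<union> B n k (- t)) \<le> (\<Sum>k\<le>m. sum E (B n k t \<union> B n k (- t)))"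
      using fin E0 by (intro sum_UNION_le) auto
    also have "\<dots> \<le> (\<Sum>k\<le>m. c * Z n + c * Z n)"
    proof (rule sum_mono)
      fix k assume "k \<in> {..m}"
      then have "sum E (B n k t) \<le> c * Z n" "sum E (B n k (- t)) \<le> c * Z n"
        using elim(1) by (auto simp: E_def)
      moreover have "sum E (B n k t \<union> B n k (- t)) \<le> sum E (B n k t) + sum E (B n k (- t))"
        using fin E0 by (intro sum_Un_le) auto
      ultimately show "sum E (B n k t \<union> B n k (- t)) \<le> c * Z n + c * Z n" by linarith
    qed
    also have "\<dots> = Z n / 2"
    proof -
      have "real (m + 1) * c = 1 / 4" by (simp add: c_def del: of_nat_add of_nat_Suc)
      then have "real (m + 1) * (c * Z n + c * Z n) = Z n / 2"
        by (simp only: distrib_left mult.assoc[symmetric])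
      then show ?thesis by simp
    qed
    finally have "Z n / 2 \<le> sum E G" by simp
    \<comment> \<open>Within \<open>G\<close> the passage time is linear in the bin frequencies, so
      replacing these by g changes it by at most n \<epsilon> times the sum of the |w k|.\<close>
    also have "sum E G \<le> (\<Sum>\<pi>\<in>G. exp (real n * ((\<Sum>k\<le>m. w k * g k) + \<epsilon> * (\<Sum>k\<le>m. \<bar>w k\<bar>))))"
    proof (rule sum_mono)
      fix \<pi> assume \<pi>: "\<pi> \<in> G"
      have "(\<Sum>k\<le>m. w k * measure (empirical_measure u n \<pi>) (bin_set m k))
          \<le> (\<Sum>k\<le>m. w k * g k + \<epsilon> * \<bar>w k\<bar>)"
      proof (rule sum_mono)
        fix k assume "k \<in> {..m}"
        then have "\<bar>measure (empirical_measure u n \<pi>) (bin_set m k) - g k\<bar> \<le> \<epsilon>"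
          using \<pi> by (simp add: G_def)
        then have "\<bar>w k\<bar> * \<bar>measure (empirical_measure u n \<pi>) (bin_set m k) - g k\<bar> \<le> \<bar>w k\<bar> * \<epsilon>"
          by (intro mult_left_mono) auto
        then have "\<bar>w k * (measure (empirical_measure u n \<pi>) (bin_set m k) - g k)\<bar> \<le> \<epsilon> * \<bar>w k\<bar>"
          by (simp add: abs_mult mult.commute)
        then show "w k * measure (empirical_measure u n \<pi>) (bin_set m k) \<le> w k * g k + \<epsilon> * \<bar>w k\<bar>"
          by (simp add: right_diff_distrib abs_le_iff)
      qed
      also have "\<dots> = (\<Sum>k\<le>m. w k * g k) + \<epsilon> * (\<Sum>k\<le>m. \<bar>w k\<bar>)"
        by (simp add: sum.distrib sum_distrib_left)
      finally show "E \<pi> \<le> exp (real n * ((\<Sum>k\<le>m. w k * g k) + \<epsilon> * (\<Sum>k\<le>m. \<bar>w k\<bar>)))"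
        using elim(2) by (simp add: E_def passage_time_step_fun)
    qed
    finally have le: "Z n / 2 \<le> real (card G) * exp (real n * ((\<Sum>k\<le>m. w k * g k) + \<epsilon> * (\<Sum>k\<le>m. \<bar>w k\<bar>)))"
      (is "_ \<le> _ * exp ?x") by simp
    have "Z n / 2 * exp (- ?x) \<le> real (card G) * exp ?x * exp (- ?x)"
      by (rule mult_right_mono[OF le]) simp
    also have "\<dots> = real (card G)" by (simp only: mult.assoc exp_add[symmetric]) simp
    finally have "Z n / 2 * exp (- ?x) \<le> real (card G)" .
    moreover have "Z n = exp (real n * free_energy D (step_fun m w) u n)"
      unfolding Z_def using exp_free_energy[OF D elim(2)] by simp
    moreover have "exp (real n * (free_energy D (step_fun m w) u n - (\<Sum>k\<le>m. w k * g k)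
        - \<epsilon> * (\<Sum>k\<le>m. \<bar>w k\<bar>))) = exp (real n * free_energy D (step_fun m w) u n) * exp (- ?x)"
      unfolding exp_add[symmetric] by (rule arg_cong[where f = exp]) (simp add: right_diff_distrib distrib_left)
    ultimately show ?case
      unfolding G_def[symmetric] by (simp only: times_divide_eq_left)
  qed
qed

text \<open>For each m it suffices that enough paths have nearly the bin weights of \<nu>, by
  \<open>levy_prokhorov_le_of_bins\<close>; intersecting over m gives the limit. The alternative
  \<alpha> = 0 asks for a single path per n, and makes the entropy 0 rather than -\<infinity> when
  \<beta> = 0.\<close>

lemma grid_rate_attained:
  fixes U :: "nat \<Rightarrow> nat \<Rightarrow> 'a \<Rightarrow> real"
  assumes row: "unif_row N D V" and U: "iid_unif01 M (UNIV \<times> {1..D}) (\<lambda>(i, j). U i j)"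
    and \<nu>: "prob_space \<nu>" "sets \<nu> = sets unit_borel"
    and lower: "\<And>\<tau>. \<tau> \<in> bounded_measurable \<Longrightarrow> \<beta> \<le> unif_row.mean_log_partition N D V \<tau> - (\<integral>x. \<tau> x \<partial>\<nu>)"
    and \<alpha>: "\<alpha> \<ge> 0" "\<alpha> < \<beta> \<or> \<alpha> = 0"
  shows "AE \<omega> in M. (\<lambda>n. kth_smallest (nat \<lfloor>exp (\<alpha> * real n)\<rfloor>)
        (\<lambda>\<pi>. levy_prokhorov (empirical_measure (\<lambda>i j. U i j \<omega>) n \<pi>) \<nu>) (paths D n)) \<longlonglongrightarrow> 0"
proof -
  interpret R: unif_row N D V by fact
  interpret M: prob_space M using U by (simp add: iid_unif01_def)
  have U_meas: "U i j \<in> measurable M unit_borel" if "j \<in> {1..D}" for i j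
    using U that unfolding iid_unif01_def M.indep_vars_def by force
  have prob_emp: "prob_space (empirical_measure (\<lambda>i j. U i j \<omega>) n \<pi>)"
    if "\<omega> \<in> space M" "n > 0" "\<pi> \<in> paths D n" for \<omega> n \<pi>
  proof (rule prob_space_empirical_measure)
    fix i assume "i < n"
    then have "\<pi> i \<in> {1..D}" using PiE_mem[OF that(3)[unfolded paths_def], of i] by blast
    from measurable_space[OF U_meas[OF this] that(1)] show "U i (\<pi> i) \<omega> \<in> {0..1}"
      by (simp add: space_restrict_space)
  qed (use that in simp)
  define r where "r \<omega> n = kth_smallest (nat \<lfloor>exp (\<alpha> * real n)\<rfloor>)
        (\<lambda>\<pi>. levy_prokhorov (empirical_measure (\<lambda>i j. U i j \<omega>) n \<pi>) \<nu>) (paths D n)" for \<omega> n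
  have k1: "1 \<le> nat \<lfloor>exp (\<alpha> * real n)\<rfloor>" for n
  proof -
    have "1 \<le> exp (\<alpha> * real n)" using \<alpha> by simp
    then show ?thesis by linarith
  qed
  have ev: "AE \<omega> in M. \<forall>\<^sub>F n in sequentially. r \<omega> n \<le> ereal (1 / real m)" if m: "m > 0" for m
  proof -
    \<comment> \<open>The bin tolerance for distance 1/m. One half is spent on g against the bin
      weights of \<nu>, the other on the path frequencies against g.\<close>
    define d where "d = 1 / (real m * real (m + 1))"
    \<comment> \<open>The room between \<alpha> and \<beta>. If there is none, then \<alpha> = 0 and
      one path suffices; the value 1 only has to be positive.\<close>
    define \<gamma> where "\<gamma> = (if \<alpha> < \<beta> then \<beta> - \<alpha> else 1)"
    have d: "d > 0" and \<gamma>: "\<gamma> > 0" using m by (auto simp: d_def \<gamma>_def)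
    define L where "L w = R.mean_log_partition (step_fun m w)" for w
    define p where "p k = measure \<nu> (bin_set m k)" for k
    have "\<exists>w g. (\<forall>k\<le>m. \<forall>t. \<bar>t\<bar> \<le> 1 \<longrightarrow> L (w(k := w k + t)) \<le> L w + t * g k + t\<^sup>2)
      \<and> (\<forall>k\<le>m. \<bar>g k - p k\<bar> \<le> min (d / 2) (\<gamma> / 4))
      \<and> \<beta> - min (d / 2) (\<gamma> / 4) \<le> L w - (\<Sum>k\<le>m. w k * g k)"
    proof (rule approximate_critical_point)
      show "\<exists>g. \<forall>t. \<bar>t\<bar> \<le> 1 \<longrightarrow> L (w(k := w k + t)) \<le> L w + t * g + t\<^sup>2" if "k \<le> m" for w k
        unfolding L_def step_fun_update[OF that]
        by (rule R.mean_log_partition_tilt[OF bounded_measurable_step_fun bounded_measurable_bin_set])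
          (simp_all add: indicator_le_1)
      show "\<beta> \<le> L w - (\<Sum>k\<le>m. w k * p k)" for w
        using lower[OF bounded_measurable_step_fun, of m w] unfolding L_def p_def integral_step_fun[OF \<nu>] .
    qed (use d \<gamma> in auto)
    then obtain w g where tilt: "\<And>k t. k \<le> m \<Longrightarrow> \<bar>t\<bar> \<le> 1 \<Longrightarrow> L (w(k := w k + t)) \<le> L w + t * g k + t\<^sup>2"
      and gp: "\<And>k. k \<le> m \<Longrightarrow> \<bar>g k - p k\<bar> \<le> d / 2"
      and crit: "\<beta> - \<gamma> / 4 \<le> L w - (\<Sum>k\<le>m. w k * g k)"
      by fastforce
    define W where "W = (\<Sum>k\<le>m. \<bar>w k\<bar>)"
    have W: "W \<ge> 0" by (simp add: W_def sum_nonneg)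
    \<comment> \<open>Chosen after w, since it has to make \<epsilon> W at most \<gamma> / 4; the
      denominator 1 + W stays positive when all weights vanish.\<close>
    define \<epsilon> where "\<epsilon> = min (min 1 (d / 2)) (\<gamma> / 4 / (1 + W))"
    have \<epsilon>: "\<epsilon> > 0" using d \<gamma> W by (simp add: \<epsilon>_def)
    have \<epsilon>_le: "\<epsilon> \<le> 1" "\<epsilon> \<le> d / 2" unfolding \<epsilon>_def by linarith+
    have \<epsilon>W: "\<epsilon> * W \<le> \<gamma> / 4"
    proof -
      have "\<epsilon> \<le> \<gamma> / 4 / (1 + W)" by (simp add: \<epsilon>_def)
      then have "\<epsilon> * (1 + W) \<le> \<gamma> / 4" using W by (subst (asm) pos_le_divide_eq) auto
      then show ?thesis using \<epsilon> by (simp add: distrib_left)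
    qed
    define t where "t = \<epsilon> / 2"
    have t: "0 < t" "t < \<epsilon>" "t \<le> 1" using \<epsilon> \<epsilon>_le by (auto simp: t_def)
    have "AE \<omega> in M. \<forall>(k, s)\<in>{..m} \<times> {t, - t}.
        (\<lambda>n. free_energy D (step_fun m (w(k := w k + s))) (\<lambda>i j. U i j \<omega>) n) \<longlonglongrightarrow> L (w(k := w k + s))"
      unfolding L_def case_prod_unfold
      by (intro AE_finite_allI free_energy_tendsto[OF row U] bounded_measurable_step_fun) auto
    moreover have "AE \<omega> in M. (\<lambda>n. free_energy D (step_fun m w) (\<lambda>i j. U i j \<omega>) n) \<longlonglongrightarrow> L w"
      unfolding L_def by (intro free_energy_tendsto[OF row U] bounded_measurable_step_fun)
    ultimately show ?thesis using AE_space
    proof eventually_elim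
      case (elim \<omega>)
      define u where "u i j = U i j \<omega>" for i j
      have fe: "(\<lambda>n. free_energy D (step_fun m w) u n) \<longlonglongrightarrow> L w"
        using elim(2) by (simp add: u_def[abs_def])
      have "\<forall>\<^sub>F n in sequentially.
          exp (real n * (free_energy D (step_fun m w) u n - (\<Sum>k\<le>m. w k * g k) - \<epsilon> * (\<Sum>k\<le>m. \<bar>w k\<bar>))) / 2
          \<le> real (card {\<pi>\<in>paths D n. \<forall>k\<le>m. \<bar>measure (empirical_measure u n \<pi>) (bin_set m k) - g k\<bar> \<le> \<epsilon>})"
      proof (rule many_paths_near_critical[where L = L and t = t])
        show "(\<lambda>n. free_energy D (step_fun m (w(k := w k + s))) u n) \<longlonglongrightarrow> L (w(k := w k + s))"
          if "k \<le> m" "s \<in> {t, - t}" for k s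
          using elim(1) that unfolding u_def[abs_def] by blast
        show "L (w(k := w k + s)) \<le> L w + s * g k + s\<^sup>2" if "k \<le> m" "s \<in> {t, - t}" for k s
          using that t by (intro tilt) auto
      qed (use R.D \<epsilon> t fe in auto)
      moreover have "\<forall>\<^sub>F n in sequentially. L w - \<gamma> / 4 < free_energy D (step_fun m w) u n"
        using \<gamma> by (intro order_tendstoD(1)[OF fe]) simp
      moreover have "\<forall>\<^sub>F n in sequentially. real n * (\<gamma> / 4) > ln 2"
        using \<gamma> by (intro filterlim_at_top_dense[THEN iffD1, rule_format]
            filterlim_at_top_mult_tendsto_pos[OF tendsto_const] filterlim_real_sequentially) auto
      ultimately show ?case using eventually_gt_at_top[of 0]
      proof eventually_elim
        case (elim n)
        define G where "G = {\<pi>\<in>paths D n. \<forall>k\<le>m. \<bar>measure (empirical_measure u n \<pi>) (bin_set m k) - g k\<bar> \<le> \<epsilon>}"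
        define H where "H = {\<pi>\<in>paths D n. levy_prokhorov (empirical_measure u n \<pi>) \<nu> \<le> 1 / real m}"
        have "G \<subseteq> H"
        proof
          fix \<pi> assume \<pi>: "\<pi> \<in> G"
          have "levy_prokhorov (empirical_measure u n \<pi>) \<nu> \<le> 1 / real m"
          proof (rule levy_prokhorov_le_of_bins[OF _ _ \<nu> m])
            show "prob_space (empirical_measure u n \<pi>)"
              using prob_emp[OF \<open>\<omega> \<in> space M\<close> elim(4)] \<pi> by (simp add: G_def u_def[abs_def])
            show "\<bar>measure (empirical_measure u n \<pi>) (bin_set m k) - measure \<nu> (bin_set m k)\<bar> \<le> d"
              if "k \<le> m" for k
            proof -
              have "\<bar>measure (empirical_measure u n \<pi>) (bin_set m k) - g k\<bar> \<le> \<epsilon>"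
                using \<pi> that by (simp add: G_def)
              then show ?thesis using gp[OF that] \<epsilon>_le(2) unfolding p_def by linarith
            qed
            show "real (m + 1) * d \<le> 1 / real m" by (simp add: d_def)
          qed simp
          then show "\<pi> \<in> H" using \<pi> by (simp add: G_def H_def)
        qed
        then have card_GH: "card G \<le> card H" using finite_paths by (intro card_mono) (auto simp: H_def)
        have card_G: "exp (real n * (free_energy D (step_fun m w) u n - (\<Sum>k\<le>m. w k * g k) - \<epsilon> * W)) / 2 \<le> real (card G)"
          using elim(1) by (simp add: G_def W_def)
        have "real (nat \<lfloor>exp (\<alpha> * real n)\<rfloor>) \<le> real (card G)"
        proof (cases "\<alpha> < \<beta>")
          case True
          \<comment> \<open>Of the room \<gamma> three quarters are spent: on criticality, on
            convergence of the free energy, and on \<epsilon> W. The last quarter absorbs the factor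
            1/2 in the count.\<close>
          have "\<alpha> + \<gamma> / 4 \<le> free_energy D (step_fun m w) u n - (\<Sum>k\<le>m. w k * g k) - \<epsilon> * W"
          proof -
            have "\<gamma> = \<beta> - \<alpha>" using True by (simp add: \<gamma>_def)
            then show ?thesis using elim(2) crit \<epsilon>W by linarith
          qed
          then have "real n * (\<alpha> + \<gamma> / 4)
              \<le> real n * (free_energy D (step_fun m w) u n - (\<Sum>k\<le>m. w k * g k) - \<epsilon> * W)"
            by (intro mult_left_mono) auto
          then have "ln 2 + \<alpha> * real n
              \<le> real n * (free_energy D (step_fun m w) u n - (\<Sum>k\<le>m. w k * g k) - \<epsilon> * W)"
            using elim(3) by (simp add: distrib_left mult.commute)
          then have "exp (ln 2 + \<alpha> * real n)
              \<le> exp (real n * (free_energy D (step_fun m w) u n - (\<Sum>k\<le>m. w k * g k) - \<epsilon> * W))"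
            by simp
          then have "exp (\<alpha> * real n) \<le> real (card G)" using card_G by (simp add: exp_add)
          moreover have "real (nat \<lfloor>exp (\<alpha> * real n)\<rfloor>) \<le> exp (\<alpha> * real n)" by simp
          ultimately show ?thesis by linarith
        next
          case False
          \<comment> \<open>Here the lower bound on \<open>card G\<close> may be tiny, but its
            positivity already yields one path.\<close>
          then have "nat \<lfloor>exp (\<alpha> * real n)\<rfloor> = 1" using \<alpha>(2) by simp
          moreover have "0 < real (card G)" by (rule less_le_trans[OF _ card_G]) simp
          ultimately show ?thesis by simp
        qed
        then have "nat \<lfloor>exp (\<alpha> * real n)\<rfloor> \<le> card H" using card_GH by linarith
        then have "kth_smallest (nat \<lfloor>exp (\<alpha> * real n)\<rfloor>)
            (\<lambda>\<pi>. levy_prokhorov (empirical_measure u n \<pi>) \<nu>) (paths D n) \<le> ereal (1 / real m)"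
          unfolding H_def by (intro kth_smallest_leI finite_paths k1)
        then show ?case by (simp add: r_def u_def[abs_def])
      qed
    qed
  qed
  have "AE \<omega> in M. \<forall>m. \<forall>\<^sub>F n in sequentially. r \<omega> n \<le> ereal (1 / real (Suc m))"
    by (intro AE_all_countable[THEN iffD2] allI ev) simp
  with AE_space show ?thesis
    unfolding r_def[symmetric]
  proof eventually_elim
    case (elim \<omega>)
    show ?case
    proof (rule order_tendstoI)
      fix a :: ereal assume a: "a < 0"
      show "\<forall>\<^sub>F n in sequentially. a < r \<omega> n"
        \<comment> \<open>At n = 0 the empirical measure is not a probability measure, so
          nonnegativity of the distance is claimed for n > 0 only.\<close>
        using eventually_gt_at_top[of 0]
      proof eventually_elim
        case (elim n)
        have "0 \<le> r \<omega> n"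
          unfolding r_def using levy_prokhorov_nonneg[OF prob_emp[OF \<open>\<omega> \<in> space M\<close> elim] \<nu>(1)]
          by (intro kth_smallest_nonneg finite_paths k1)
        then show ?case using a by (rule less_le_trans[rotated])
      qed
    next
      fix a :: ereal assume a: "0 < a"
      obtain e where e: "0 < ereal e" "ereal e < a" using ereal_dense2[OF a] by blast
      then obtain m where "1 / real (Suc m) < e" using nat_approx_posE[of e] by auto
      then have "ereal (1 / real (Suc m)) < ereal e" by (simp only: less_ereal.simps)
      then have m: "ereal (1 / real (Suc m)) < a" using e(2) by (rule less_trans)
      from elim(2)[rule_format, of m] show "\<forall>\<^sub>F n in sequentially. r \<omega> n < a"
        by eventually_elim (rule le_less_trans[OF _ m])
    qed
  qed
qed

subsection \<open>The variational formula\<close>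

text \<open>The definite description is legitimate because an almost sure limit is unique: two
  candidate constants agree almost surely, hence agree, as a probability space is not null.\<close>

lemma Gibbs_free_energy_eq:
  fixes U :: "nat \<Rightarrow> nat \<Rightarrow> 'a \<Rightarrow> real"
  assumes row: "unif_row N D V" and U: "iid_unif01 M (UNIV \<times> {1..D}) (\<lambda>(i, j). U i j)"
    and \<tau>: "\<tau> \<in> bounded_measurable"
  shows "Gibbs_free_energy M D U \<tau> = unif_row.mean_log_partition N D V \<tau>"
  unfolding Gibbs_free_energy_def
proof (rule the_equality)
  interpret M: prob_space M using U by (simp add: iid_unif01_def)
  show lim: "AE \<omega> in M. (\<lambda>n. free_energy D \<tau> (\<lambda>i j. U i j \<omega>) n) \<longlonglongrightarrow> unif_row.mean_log_partition N D V \<tau>"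
    by (rule free_energy_tendsto[OF assms])
  fix g assume "AE \<omega> in M. (\<lambda>n. free_energy D \<tau> (\<lambda>i j. U i j \<omega>) n) \<longlonglongrightarrow> g"
  with lim have "AE \<omega> in M. g = unif_row.mean_log_partition N D V \<tau>"
    by eventually_elim (rule LIMSEQ_unique)
  then show "g = unif_row.mean_log_partition N D V \<tau>" by simp
qed

text \<open>Replace \<open>\<tau>\<close> by its multiples \<open>n \<tau>\<close>, whose mean log-partition is at most \<open>n\<close> times that of \<open>\<tau>\<close>.
  This rules out a supremum in \<open>(0, \<infinity>)\<close>, which \<open>grid_entropy\<close> could not attain as it is
  never in \<open>(-\<infinity>, 0)\<close>.\<close>

lemma rate_positive_imp_infinite:
  assumes row: "unif_row N D V" and \<nu>: "prob_space \<nu>" "sets \<nu> = sets unit_borel"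
    and \<tau>: "\<tau> \<in> bounded_measurable"
    and pos: "unif_row.mean_log_partition N D V \<tau> < (\<integral>x. \<tau> x \<partial>\<nu>)"
  shows "(SUP \<tau>\<in>bounded_measurable. ereal ((\<integral>x. \<tau> x \<partial>\<nu>) - unif_row.mean_log_partition N D V \<tau>)) = \<infinity>"
proof -
  interpret R: unif_row N D V by fact
  define y where "y = (\<integral>x. \<tau> x \<partial>\<nu>) - R.mean_log_partition \<tau>"
  have y: "y > 0" using pos by (simp add: y_def)
  show ?thesis
  proof (rule SUP_PInfty)
    fix n :: nat
    obtain k where k: "real n / y < real k" using reals_Archimedean2 by blast
    have "real n < real k * y" using k y by (simp add: pos_divide_less_eq)
    also have "\<dots> \<le> real (Suc k) * y" using y by (intro mult_right_mono) auto
    also have "\<dots> \<le> (\<integral>x. real (Suc k) * \<tau> x \<partial>\<nu>) - R.mean_log_partition (\<lambda>x. real (Suc k) * \<tau> x)"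
      using R.mean_log_partition_mult_le[OF \<tau>, of k] unfolding y_def right_diff_distrib by simp
    finally show "\<exists>\<sigma>\<in>bounded_measurable. ereal (real n) \<le> ereal ((\<integral>x. \<sigma> x \<partial>\<nu>) - R.mean_log_partition \<sigma>)"
      by (intro bexI[of _ "\<lambda>x. real (Suc k) * \<tau> x"] bounded_measurable_cmult \<tau>) simp
  qed
qed

text \<open>If S = \<infinity>, the bound from \<open>grid_rate_le\<close> already forces the
  entropy to be -\<infinity>. Otherwise S = -\<beta>, the scaling argument gives \<beta> \<ge> 0,
  and every nonnegative rate below \<beta> as well as 0 is attained.\<close>

lemma grid_entropy_eq:
  fixes U :: "nat \<Rightarrow> nat \<Rightarrow> 'a \<Rightarrow> real"
  assumes row: "unif_row N D V" and U: "iid_unif01 M (UNIV \<times> {1..D}) (\<lambda>(i, j). U i j)"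
    and \<nu>: "prob_space \<nu>" "sets \<nu> = sets unit_borel"
  shows "- grid_entropy M D U \<nu>
    = (SUP \<tau>\<in>bounded_measurable. ereal ((\<integral>x. \<tau> x \<partial>\<nu>) - unif_row.mean_log_partition N D V \<tau>))"
proof -
  interpret R: unif_row N D V by fact
  define S where "S = (SUP \<tau>\<in>bounded_measurable. ereal ((\<integral>x. \<tau> x \<partial>\<nu>) - R.mean_log_partition \<tau>))"
  have S_ge: "ereal ((\<integral>x. \<tau> x \<partial>\<nu>) - R.mean_log_partition \<tau>) \<le> S" if "\<tau> \<in> bounded_measurable" for \<tau>
    unfolding S_def using that by (rule SUP_upper)
  have "grid_entropy M D U \<nu> \<le> - S"
    unfolding grid_entropy_def
  proof (rule Sup_least, clarify)
    fix \<alpha> assume "\<alpha> \<ge> 0" and lim: "AE \<omega> in M. (\<lambda>n. kth_smallest (nat \<lfloor>exp (\<alpha> * real n)\<rfloor>)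
        (\<lambda>\<pi>. levy_prokhorov (empirical_measure (\<lambda>i j. U i j \<omega>) n \<pi>) \<nu>) (paths D n)) \<longlonglongrightarrow> 0"
    have "S \<le> ereal (- \<alpha>)"
      unfolding S_def
    proof (rule SUP_least)
      fix \<tau> assume "\<tau> \<in> bounded_measurable"
      from grid_rate_le[OF row U this \<nu> \<open>\<alpha> \<ge> 0\<close> lim]
      show "ereal ((\<integral>x. \<tau> x \<partial>\<nu>) - R.mean_log_partition \<tau>) \<le> ereal (- \<alpha>)" by simp
    qed
    then show "ereal \<alpha> \<le> - S" by (cases S) auto
  qed
  moreover have "- S \<le> grid_entropy M D U \<nu>"
  proof (cases "S = \<infinity>")
    case False
    have "S \<noteq> - \<infinity>" using S_ge[OF bounded_measurable_const[of 0]] by auto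
    with False obtain \<beta> where \<beta>: "S = ereal (- \<beta>)" by (cases S) (auto intro: that[of "- _"])
    have lower: "\<beta> \<le> R.mean_log_partition \<tau> - (\<integral>x. \<tau> x \<partial>\<nu>)" if "\<tau> \<in> bounded_measurable" for \<tau>
      using S_ge[OF that] by (simp add: \<beta>)
    have "(\<integral>x. \<tau> x \<partial>\<nu>) \<le> R.mean_log_partition \<tau>" if "\<tau> \<in> bounded_measurable" for \<tau>
      using rate_positive_imp_infinite[OF row \<nu> that] False unfolding S_def by fastforce
    then have "S \<le> ereal 0" unfolding S_def by (intro SUP_least) simp
    then have \<beta>0: "\<beta> \<ge> 0" by (simp add: \<beta>)
    have attained: "ereal \<alpha> \<le> grid_entropy M D U \<nu>" if "\<alpha> \<ge> 0" "\<alpha> < \<beta> \<or> \<alpha> = 0" for \<alpha>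
      unfolding grid_entropy_def using grid_rate_attained[OF row U \<nu> lower that] that(1)
      by (intro Sup_upper) blast
    have "ereal \<beta> \<le> grid_entropy M D U \<nu>"
    proof (rule dense_le)
      fix x assume x: "x < ereal \<beta>"
      obtain \<alpha> where \<alpha>: "x < ereal \<alpha>" "\<alpha> < \<beta>" using ereal_dense2[OF x] by auto
      \<comment> \<open>The rate found by density may be negative, while only nonnegative rates are
        admissible; when it is, the rate 0 takes its place, which also settles \<beta> = 0.\<close>
      have "ereal \<alpha> \<le> ereal (max 0 \<alpha>)" by simp
      also have "\<dots> \<le> grid_entropy M D U \<nu>" using \<alpha>(2) by (intro attained) auto
      finally show "x \<le> grid_entropy M D U \<nu>" using \<alpha>(1) by (meson less_imp_le order_trans)
    qed
    then show ?thesis by (simp add: \<beta>)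
  qed simp
  ultimately show ?thesis
    unfolding S_def[symmetric] by (metis antisym ereal_uminus_uminus)
qed

theorem theoremD:
  fixes M :: "'a measure" and N :: "'b measure" and D :: nat
    and U :: "nat \<Rightarrow> nat \<Rightarrow> 'a \<Rightarrow> real" and V :: "nat \<Rightarrow> 'b \<Rightarrow> real"
  assumes "D \<ge> 1"
    and "iid_unif01 M (UNIV \<times> {1..D}) (\<lambda>(i, j). U i j)"
    and "iid_unif01 N {1..D} V"
  shows "(\<forall>\<tau>\<in>bounded_measurable.
            (AE \<omega> in M. (\<lambda>n. free_energy D \<tau> (\<lambda>i j. U i j \<omega>) n) \<longlonglongrightarrow> Gibbs_free_energy M D U \<tau>)
            \<and> Gibbs_free_energy M D U \<tau>
                = prob_space.expectation N (\<lambda>x. ln (\<Sum>j=1..D. exp (\<tau> (V j x)))))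
       \<and> (\<forall>\<nu>. prob_space \<nu> \<and> sets \<nu> = sets unit_borel \<longrightarrow>
            - grid_entropy M D U \<nu>
                = (SUP \<tau>\<in>bounded_measurable.
                     ereal ((\<integral>u. \<tau> u \<partial>\<nu>) - Gibbs_free_energy M D U \<tau>))
            \<and> (SUP \<tau>\<in>bounded_measurable.
                  ereal ((\<integral>u. \<tau> u \<partial>\<nu>) - Gibbs_free_energy M D U \<tau>))
                = (SUP \<tau>\<in>bounded_measurable.
                     ereal ((\<integral>u. \<tau> u \<partial>\<nu>)
                       - prob_space.expectation N (\<lambda>x. ln (\<Sum>j=1..D. exp (\<tau> (V j x)))))))"
proof -
  have "prob_space N" using assms(3) by (simp add: iid_unif01_def)
  then have row: "unif_row N D V"
    using assms by (simp add: unif_row_def unif_row_axioms_def)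
  have mean: "unif_row.mean_log_partition N D V \<tau>
      = prob_space.expectation N (\<lambda>x. ln (\<Sum>j=1..D. exp (\<tau> (V j x))))" for \<tau>
    by (simp add: unif_row.mean_log_partition_def[OF row] log_partition_def)
  have Gibbs: "Gibbs_free_energy M D U \<tau>
      = prob_space.expectation N (\<lambda>x. ln (\<Sum>j=1..D. exp (\<tau> (V j x))))" if "\<tau> \<in> bounded_measurable" for \<tau>
    using Gibbs_free_energy_eq[OF row assms(2) that] unfolding mean .
  have SUP_eq: "(SUP \<tau>\<in>bounded_measurable. ereal ((\<integral>u. \<tau> u \<partial>\<nu>) - Gibbs_free_energy M D U \<tau>))
      = (SUP \<tau>\<in>bounded_measurable. ereal ((\<integral>u. \<tau> u \<partial>\<nu>)
          - prob_space.expectation N (\<lambda>x. ln (\<Sum>j=1..D. exp (\<tau> (V j x))))))" for \<nu> :: "real measure"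
    by (intro SUP_cong refl) (simp only: Gibbs)
  show ?thesis
  proof (intro conjI ballI allI impI)
    fix \<tau> assume \<tau>: "\<tau> \<in> bounded_measurable"
    show "AE \<omega> in M. (\<lambda>n. free_energy D \<tau> (\<lambda>i j. U i j \<omega>) n) \<longlonglongrightarrow> Gibbs_free_energy M D U \<tau>"
      unfolding Gibbs_free_energy_eq[OF row assms(2) \<tau>] by (rule free_energy_tendsto[OF row assms(2) \<tau>])
    show "Gibbs_free_energy M D U \<tau>
        = prob_space.expectation N (\<lambda>x. ln (\<Sum>j=1..D. exp (\<tau> (V j x))))"
      by (rule Gibbs[OF \<tau>])
  next
    fix \<nu> :: "real measure" assume "prob_space \<nu> \<and> sets \<nu> = sets unit_borel"
    then show "- grid_entropy M D U \<nu>
        = (SUP \<tau>\<in>bounded_measurable. ereal ((\<integral>u. \<tau> u \<partial>\<nu>) - Gibbs_free_energy M D U \<tau>))"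
      unfolding SUP_eq using grid_entropy_eq[OF row assms(2), of \<nu>] unfolding mean by blast
  qed (rule SUP_eq)
qed

end
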